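(* Let $k\in\{0,1,2,\dots\}$, $\lambda>0$, $\psi,\phi\in(0,\pi)$, and let $\rho\in\mathbb{C}$ be such that $$|\rho|\,\bigl(\sin\phi+|\sin(\psi-\phi)|\bigr)<\sin\psi.$$ Then $$ \int_{-\infty}^\infty (1-e^{i\phi}\rho)^{-\lambda+ix}(1-e^{-i\phi}\rho)^{-\lambda-ix}\,e^{(2\psi-\pi)x}\,|\Gamma(\lambda+ix)|^2\,P_k^{(\lambda)}(x;\psi)\,dx =\left(1-\rho\,\frac{\sin(\psi-\phi)}{\sin\psi}\right)^{-2\lambda}\frac{2\pi\,\Gamma(k+2\lambda)\,\tilde\rho^{\,k}}{(2\sin\psi)^{2\lambda}\,k!}, $$ where $$\tilde\rho=\frac{\rho\sin\phi}{\sin\psi-\rho\sin(\psi-\phi)}.$$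
   Context: The Pochhammer symbol is $(z)_n=\prod_{i=1}^n(z+i-1)$, and ${}_2F_1(a_1,a_2;b_1;z)=\sum_{n\ge0}\frac{(a_1)_n(a_2)_n}{(b_1)_n}\frac{z^n}{n!}$. The Meixner-Pollaczek polynomials are $$P_n^{(\lambda)}(x;\phi)=\frac{(2\lambda)_n}{n!}e^{in\phi}\ {}_2F_1\!\left(\begin{matrix}-n,\ \lambda+ix\\ 2\lambda\end{matrix};1-e^{-2i\phi}\right).$$ The assumption on $\rho$ implies $|\rho|<1$; all complex powers are taken with the principal branch. *)

theory Defs
  imports "HOL-Analysis.Analysis"
begin

definition hyp2F1 :: "complex \<Rightarrow> complex \<Rightarrow> complex \<Rightarrow> complex \<Rightarrow> complex" where
  "hyp2F1 a1 a2 b1 z =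
     (\<Sum>n. pochhammer a1 n * pochhammer a2 n / pochhammer b1 n * (z ^ n / fact n))"

text \<open>
  The first numerator parameter is the nonpositive integer \<open>- n\<close>, so the series terminates and
  its value is meaningful even where \<open>1 - exp (- 2 \<i> \<phi>)\<close> lies outside the unit disc.
\<close>
definition meixner_pollaczek :: "nat \<Rightarrow> real \<Rightarrow> real \<Rightarrow> real \<Rightarrow> complex" where
  "meixner_pollaczek n lam x \<phi> =
     pochhammer (2 * of_real lam) n / fact n * exp (\<i> * of_nat n * of_real \<phi>)
     * hyp2F1 (- of_nat n) (of_real lam + \<i> * of_real x) (2 * of_real lam)
         (1 - exp (- 2 * \<i> * of_real \<phi>))"

end

(*
  Since |Gamma(lambda + i x)|^2 = Gamma(lambda + i x) Gamma(lambda - i x), and the n-th term of P_k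
  turns the first factor into Gamma(lambda + n + i x), everything reduces to the integral
    int Gamma(a + i x) Gamma(b - i x) e^(-i x L) dx = 2 pi Gamma(a + b) e^(a L) (1 + e^L)^(-a-b)
  for |Im L| < pi. For real L it is Fourier inversion of the beta integral; the exponential decay of
  Gamma on vertical lines allows analytic continuation in L. The hypothesis on rho says that the
  relevant L stays in the strip. The finite sum over n is then the binomial expansion of the k-th
  power of 1 - (1 - e^(-2 i psi)) e^L / (1 + e^L) = e^(-i psi) rho~.
*)
theory Submission
  imports Defs "HOL-Probability.Characteristic_Functions" "HOL-Complex_Analysis.Conformal_Mappings"
begin

section \<open>The beta integral and Fourier inversion\<close>

text \<open>The strip |Im L| < pi is what the decay of Gamma allows: one factor decays like exp (-
  \<alpha> |x|) for every \<alpha> < pi / 2, so the product of two beats exp (\<theta> |x|) for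
  every \<theta> < pi. Since the rates stay strictly below the limit, polynomial factors can be
  absorbed.

  The obstacle is the choice of branches. L is assembled from principal logarithms, so |Im L| < pi,
  and likewise the splitting of Ln (1 + e^L) into principal logarithms, could fail by a multiple of
  2 pi i. Continuity in \<rho> excludes this once e^L is known to avoid the negative real axis.
  Solving e^L = - r for \<rho>, with r \<ge> 0, gives the quotient of e^(i \<psi>) - r e^(- i
  \<psi>) by e^(i (\<psi> - \<phi>)) - r e^(- i (\<psi> - \<phi>)). Its modulus is at least sin
  \<psi> / (sin \<phi> + |sin (\<psi> - \<phi>)|), which is the origin of the hypothesis on \<rho>.

  In the n-th term, Gamma (2 lambda + n) = (2 lambda)_n Gamma (2 lambda) cancels the denominator of
  the hypergeometric coefficient; this is why only binomial coefficients remain.\<close>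

lemma Gamma_integral_exp:
  fixes z :: complex
  assumes "Re z > 0"
  shows "has_bochner_integral lborel (\<lambda>s::real. exp (z * of_real s - of_real (exp s))) (Gamma z)"
proof -
  define f where "f = (\<lambda>t::real. of_real t powr (z - 1) / complex_of_real (exp t))"
  \<comment> \<open>The Jacobian \<open>exp s\<close> of t = exp s raises the exponent z - 1 in
    Euler's integral to z.\<close>
  have eq: "exp s *\<^sub>R f (exp s) = exp (z * of_real s - of_real (exp s))" for s :: real
  proof -
    have "of_real (exp s) powr (z - 1) = exp ((z - 1) * of_real s)"
      by (simp add: powr_def Ln_of_real del: of_real_exp)
    thus ?thesis
      by (simp add: f_def scaleR_conv_of_real exp_diff left_diff_distrib flip: exp_of_real)
  qed
  have range_exp: "range exp = {0::real<..}"
    by (auto simp: image_iff intro: exp_ln[symmetric])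
  have "f absolutely_integrable_on range exp \<and> integral (range exp) f = Gamma z"
    using absolutely_integrable_Gamma_integral'[OF assms] Gamma_integral_complex'[OF assms]
    unfolding range_exp f_def by (auto simp: integral_unique)
  hence *: "(\<lambda>s. exp (z * of_real s - of_real (exp s))) absolutely_integrable_on UNIV"
       "integral UNIV (\<lambda>s. exp (z * of_real s - of_real (exp s))) = Gamma z"
    using has_absolute_integral_change_of_variables_real[of UNIV exp exp f "Gamma z"]
    by (auto simp: eq inj_on_def intro!: derivative_eq_intros)
  hence "integrable lebesgue (\<lambda>s::real. exp (z * of_real s - of_real (exp s)))"
    by (simp add: set_integrable_def)
  hence int: "integrable lborel (\<lambda>s::real. exp (z * of_real s - of_real (exp s)))"
    by (subst (asm) integrable_completion) auto
  show ?thesis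
    unfolding has_bochner_integral_iff
    using int *(2) by (simp flip: integral_lborel)
qed

lemma Gamma_integral_exp_scaled:
  fixes z :: complex and c :: real
  assumes "Re z > 0" "c > 0"
  shows "has_bochner_integral lborel (\<lambda>s::real. exp (z * of_real s - of_real (c * exp s)))
           (Gamma z * exp (- z * of_real (ln c)))"
proof -
  have "has_bochner_integral lborel
          (\<lambda>s::real. exp (z * of_real (ln c + 1 * s) - of_real (exp (ln c + 1 * s)))) (Gamma z /\<^sub>R \<bar>1\<bar>)"
    using Gamma_integral_exp[OF assms(1)]
    by (subst (asm) lborel_has_bochner_integral_real_affine_iff[where c = 1 and t = "ln c"]) simp_all
  hence "has_bochner_integral lborel
     (\<lambda>s::real. exp (z * of_real (ln c + 1 * s) - of_real (exp (ln c + 1 * s))) * exp (- z * of_real (ln c)))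
     (Gamma z /\<^sub>R \<bar>1\<bar> * exp (- z * of_real (ln c)))"
    by (intro has_bochner_integral_mult_left) auto
  also have "(\<lambda>s::real. exp (z * of_real (ln c + 1 * s) - of_real (exp (ln c + 1 * s))) * exp (- z * of_real (ln c)))
     = (\<lambda>s. exp (z * of_real s - of_real (c * exp s)))"
    using assms(2) by (simp add: fun_eq_iff algebra_simps flip: exp_add) (simp add: exp_add mult.commute)
  finally show ?thesis by simp
qed

text \<open>
  In logarithmic coordinates both Euler integrals live on the whole line, and the substitutions in
  the classical proof of \<open>\<Gamma>(z) \<Gamma>(w) = \<Gamma>(z + w) B(z, w)\<close> become translations.
\<close>

lemma Beta_integral_exp:
  fixes z w :: complex
  assumes "Re z > 0" "Re w > 0"
  shows "has_bochner_integral lborel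
           (\<lambda>t::real. exp (z * of_real t - (z + w) * of_real (ln (1 + exp t))))
           (Gamma z * Gamma w / Gamma (z + w))"
proof -
  \<comment> \<open>The integrand of the double integral for \<open>Gamma z * Gamma w\<close>, with
    variables r + t for z and r for w. Its exponent z (r + t) - exp (r + t) + w r - exp r is
    regrouped so that r occurs only with z + w and 1 + exp t.\<close>
  define h where "h = (\<lambda>z w (r::real) (t::real).
    exp ((z + w) * of_real r - of_real ((1 + exp t) * exp r) + z * complex_of_real t))"
  have inner: "has_bochner_integral lborel (h z w r) (Gamma z * exp (w * of_real r - of_real (exp r)))"
    if "Re z > 0" for z w r
  proof -
    have "has_bochner_integral lborel
       (\<lambda>t. exp (z * of_real (r + 1 * t) - of_real (exp (r + 1 * t))) * exp (w * of_real r - of_real (exp r)))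
       (Gamma z /\<^sub>R \<bar>1\<bar> * exp (w * of_real r - of_real (exp r)))"
      using Gamma_integral_exp[OF that]
      by (intro has_bochner_integral_mult_left,
          subst (asm) lborel_has_bochner_integral_real_affine_iff[where c = 1 and t = r]) simp_all
    also have "(\<lambda>t. exp (z * of_real (r + 1 * t) - of_real (exp (r + 1 * t))) * exp (w * of_real r - of_real (exp r))) = h z w r"
      by (simp add: fun_eq_iff h_def algebra_simps exp_add[of _ r] flip: exp_add[of "_ :: complex"])
    finally show ?thesis by simp
  qed
  \<comment> \<open>The modulus is the same integrand at the real parts of the parameters, so
    \<open>inner\<close> also evaluates the integral of the norm, as Fubini requires.\<close>
  have norm_h: "norm (h z w r t) = Re (h (of_real (Re z)) (of_real (Re w)) r t)" for r t
    by (simp add: h_def Re_exp)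
  have inner_norm: "has_bochner_integral lborel (\<lambda>t. norm (h z w r t))
      (Re (Gamma (of_real (Re z)) * exp (of_real (Re w) * of_real r - of_real (exp r))))" for r
    unfolding norm_h using assms by (intro has_bochner_integral_Re inner) simp
  have "integrable (lborel \<Otimes>\<^sub>M lborel) (case_prod (h z w))"
  proof (rule lborel_pair.Fubini_integrable)
    show "case_prod (h z w) \<in> borel_measurable (lborel \<Otimes>\<^sub>M lborel)"
      unfolding h_def by measurable
    have "integrable lborel (\<lambda>r. Re (Gamma (of_real (Re z)) * exp (of_real (Re w) * of_real r - of_real (exp r))))"
      using Gamma_integral_exp[of "of_real (Re w)"] assms(2)
      by (intro integrable_Re integrable_mult_right) (auto simp: has_bochner_integral_iff)
    thus "integrable lborel (\<lambda>r. \<integral>t. norm (case_prod (h z w) (r, t)) \<partial>lborel)"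
      using inner_norm by (simp add: has_bochner_integral_iff)
    show "AE r in lborel. integrable lborel (\<lambda>t. case_prod (h z w) (r, t))"
      using inner[OF assms(1)] by (simp add: has_bochner_integral_iff)
  qed
  note fub = lborel_pair.integrable_snd[OF this] lborel_pair.Fubini_integral[OF this]
  have outer: "(\<integral>r. h z w r t \<partial>lborel) = Gamma (z + w) * exp (z * of_real t - (z + w) * of_real (ln (1 + exp t)))" for t
  proof -
    have "has_bochner_integral lborel
       (\<lambda>r::real. exp ((z + w) * of_real r - of_real ((1 + exp t) * exp r)) * exp (z * of_real t))
       (Gamma (z + w) * exp (- (z + w) * of_real (ln (1 + exp t))) * exp (z * of_real t))"
      using assms by (intro has_bochner_integral_mult_left Gamma_integral_exp_scaled) (auto simp: add_pos_pos)
    thus ?thesis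
      by (simp add: has_bochner_integral_iff h_def exp_add exp_diff exp_minus field_simps)
  qed
  have "(\<integral>r. Gamma z * exp (w * of_real r - of_real (exp r)) \<partial>lborel) = Gamma z * Gamma w"
    using Gamma_integral_exp[OF assms(2)] by (simp add: has_bochner_integral_iff)
  hence "has_bochner_integral lborel
     (\<lambda>t. Gamma (z + w) * exp (z * of_real t - (z + w) * of_real (ln (1 + exp t)))) (Gamma z * Gamma w)"
    using fub inner[OF assms(1)] by (simp add: has_bochner_integral_iff outer)
  hence "has_bochner_integral lborel
     (\<lambda>t. (Gamma (z + w) * exp (z * of_real t - (z + w) * of_real (ln (1 + exp t)))) / Gamma (z + w))
     (Gamma z * Gamma w / Gamma (z + w))"
    by (rule has_bochner_integral_divide)
  moreover have "Gamma (z + w) \<noteq> 0"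
    using assms by (auto simp: Gamma_eq_zero_iff elim!: nonpos_Ints_cases dest!: arg_cong[where f = Re])
  ultimately show ?thesis by simp
qed

text \<open>The characteristic function of the standard normal law, rescaled by \<sigma>. Writing
  the value as a normal density exhibits it as 2 pi times an approximate identity for \<sigma>
  tending to 0.\<close>

lemma gaussian_fourier:
  fixes y \<sigma> :: real
  assumes "\<sigma> > 0"
  shows "has_bochner_integral lborel (\<lambda>x::real. exp (\<i> * of_real (x * y)) * of_real (exp (- (\<sigma> * x)\<^sup>2 / 2)))
           (of_real (2 * pi / \<sigma> * std_normal_density (y / \<sigma>)))"
proof -
  have *: "has_bochner_integral lborel (\<lambda>x. std_normal_density x *\<^sub>R exp (\<i> * of_real (v * x)))
          (of_real (exp (- v\<^sup>2 / 2)))" for v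
  proof -
    have "integrable lborel (\<lambda>x. std_normal_density x *\<^sub>R exp (\<i> * of_real (v * x)))"
      by (rule Bochner_Integration.integrable_bound[OF integrable_normal_density[of 1 0]]) (auto simp: norm_mult)
    thus ?thesis
      using fun_cong[OF char_std_normal_distribution, of v]
      by (simp add: has_bochner_integral_iff char_def integral_density)
  qed
  have "has_bochner_integral lborel (\<lambda>x. (std_normal_density (0 + \<sigma> * x) *\<^sub>R exp (\<i> * of_real (y / \<sigma> * (0 + \<sigma> * x)))) * of_real (sqrt (2 * pi)))
          ((of_real (exp (- (y / \<sigma>)\<^sup>2 / 2)) /\<^sub>R \<bar>\<sigma>\<bar>) * of_real (sqrt (2 * pi)))"
    using *[of "y / \<sigma>"] assms
    by (intro has_bochner_integral_mult_left,
        subst (asm) lborel_has_bochner_integral_real_affine_iff[where c = \<sigma> and t = 0]) auto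
  also have "(\<lambda>x. (std_normal_density (0 + \<sigma> * x) *\<^sub>R exp (\<i> * of_real (y / \<sigma> * (0 + \<sigma> * x)))) * of_real (sqrt (2 * pi)))
     = (\<lambda>x::real. exp (\<i> * of_real (x * y)) * of_real (exp (- (\<sigma> * x)\<^sup>2 / 2)))"
    using assms by (simp add: fun_eq_iff std_normal_density_def scaleR_conv_of_real mult_ac)
  also have "(of_real (exp (- (y / \<sigma>)\<^sup>2 / 2)) /\<^sub>R \<bar>\<sigma>\<bar>) * of_real (sqrt (2 * pi)) =
     complex_of_real (exp (- (y / \<sigma>)\<^sup>2 / 2) / \<sigma> * sqrt (2 * pi))"
    using assms by (simp add: scaleR_conv_of_real divide_simps)
  also have "exp (- (y / \<sigma>)\<^sup>2 / 2) / \<sigma> * sqrt (2 * pi) = 2 * pi / \<sigma> * std_normal_density (y / \<sigma>)"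
  proof -
    have "2 * pi / \<sigma> * std_normal_density (y / \<sigma>) = 2 * pi / sqrt (2 * pi) * (exp (- (y / \<sigma>)\<^sup>2 / 2) / \<sigma>)"
      by (simp add: std_normal_density_def)
    also have "2 * pi / sqrt (2 * pi) = sqrt (2 * pi)" by (rule real_div_sqrt) simp
    also have "sqrt (2 * pi) * (exp (- (y / \<sigma>)\<^sup>2 / 2) / \<sigma>) = exp (- (y / \<sigma>)\<^sup>2 / 2) / \<sigma> * sqrt (2 * pi)"
      by (rule mult.commute)
    finally show ?thesis by (rule sym)
  qed
  finally show ?thesis .
qed

lemma fourier_inversion:
  fixes f :: "real \<Rightarrow> complex" and B :: real
  assumes int: "integrable lborel f" and cont: "continuous_on UNIV f" and bd: "\<And>s. norm (f s) \<le> B"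
    and G: "\<And>x. G x = (\<integral>s. f s * exp (\<i> * of_real (x * s)) \<partial>lborel)" and intG: "integrable lborel G"
  shows "(\<integral>x. G x * exp (- (\<i> * of_real (x * t))) \<partial>lborel) = 2 * pi * f t"
proof -
  have [measurable]: "f \<in> borel_measurable borel" "G \<in> borel_measurable borel"
    using int intG by auto
  \<comment> \<open>Damping by the Gaussian \<open>w \<sigma>\<close> makes Fubini applicable; then \<open>\<sigma> \<rightarrow> 0\<close>.\<close>
  define w where "w = (\<lambda>\<sigma> x::real. exp (- (\<sigma> * x)\<^sup>2 / 2))"
  have mollified: "(\<integral>x. G x * exp (- (\<i> * of_real (x * t))) * of_real (w \<sigma> x) \<partial>lborel)
      = 2 * pi * (\<integral>u. f (t + \<sigma> * u) * of_real (std_normal_density u) \<partial>lborel)" if \<sigma>: "\<sigma> > 0" for \<sigma>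
  proof -
    define h where "h = (\<lambda>x s. f s * (exp (\<i> * of_real (x * (s - t))) * complex_of_real (w \<sigma> x)))"
    have w_int: "integrable lborel (\<lambda>x. norm (w \<sigma> x))"
      using gaussian_fourier[OF \<sigma>, of 0] by (auto simp: has_bochner_integral_iff w_def dest: integrable_Re)
    have "integrable (lborel \<Otimes>\<^sub>M lborel) (case_prod h)"
    proof (rule lborel_pair.Fubini_integrable)
      show "case_prod h \<in> borel_measurable (lborel \<Otimes>\<^sub>M lborel)"
        unfolding h_def w_def by measurable
      show "integrable lborel (\<lambda>x. \<integral>s. norm (case_prod h (x, s)) \<partial>lborel)"
        using w_int int by (simp add: h_def norm_mult)
      show "AE x in lborel. integrable lborel (\<lambda>s. case_prod h (x, s))"
      proof (intro AE_I2)
        fix x :: real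
        show "integrable lborel (\<lambda>s. case_prod h (x, s))"
          by (rule Bochner_Integration.integrable_bound[OF integrable_mult_right[OF integrable_norm[OF int], of "w \<sigma> x"]])
             (auto simp: h_def norm_mult w_def)
      qed
    qed
    note fub = lborel_pair.Fubini_integral[OF this]
    have "(\<integral>s. h x s \<partial>lborel) = G x * exp (- (\<i> * of_real (x * t))) * of_real (w \<sigma> x)" for x
    proof -
      have "(\<integral>s. h x s \<partial>lborel) = (\<integral>s. f s * exp (\<i> * of_real (x * s)) * (exp (- (\<i> * of_real (x * t))) * of_real (w \<sigma> x)) \<partial>lborel)"
        by (intro Bochner_Integration.integral_cong) (auto simp: h_def algebra_simps exp_diff exp_minus field_simps)
      thus ?thesis by (simp add: G)
    qed
    moreover have "(\<integral>x. h x s \<partial>lborel) = f s * of_real (2 * pi / \<sigma> * std_normal_density ((s - t) / \<sigma>))" for s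
      using gaussian_fourier[OF \<sigma>, of "s - t"] by (simp add: has_bochner_integral_iff h_def w_def)
    ultimately have "(\<integral>x. G x * exp (- (\<i> * of_real (x * t))) * of_real (w \<sigma> x) \<partial>lborel)
       = (\<integral>s. f s * of_real (2 * pi / \<sigma> * std_normal_density ((s - t) / \<sigma>)) \<partial>lborel)"
      using fub by simp
    \<comment> \<open>The substitution s = t + \<sigma> u cancels the factor 1 / \<sigma> and moves
      \<sigma> into the argument of f.\<close>
    also have "\<dots> = \<bar>\<sigma>\<bar> *\<^sub>R (\<integral>u. f (t + \<sigma> * u) * of_real (2 * pi / \<sigma> * std_normal_density ((t + \<sigma> * u - t) / \<sigma>)) \<partial>lborel)"
      using \<sigma> by (intro lborel_integral_real_affine) simp
    also have "\<dots> = (\<integral>u. \<sigma> *\<^sub>R (f (t + \<sigma> * u) * of_real (2 * pi / \<sigma> * std_normal_density ((t + \<sigma> * u - t) / \<sigma>))) \<partial>lborel)"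
      using \<sigma> by simp
    also have "\<dots> = (\<integral>u. 2 * pi * (f (t + \<sigma> * u) * of_real (std_normal_density u)) \<partial>lborel)"
      using \<sigma> by (intro Bochner_Integration.integral_cong) (auto simp: scaleR_conv_of_real)
    finally show ?thesis by simp
  qed
  define \<sigma> where "\<sigma> = (\<lambda>n::nat. inverse (real (Suc n)))"
  have \<sigma>: "\<sigma> n > 0" for n by (simp add: \<sigma>_def)
  have \<sigma>0: "\<sigma> \<longlonglongrightarrow> 0" unfolding \<sigma>_def by (rule LIMSEQ_inverse_real_of_nat)
  have "(\<lambda>n. \<integral>x. G x * exp (- (\<i> * of_real (x * t))) * of_real (w (\<sigma> n) x) \<partial>lborel)
      \<longlonglongrightarrow> (\<integral>x. G x * exp (- (\<i> * of_real (x * t))) \<partial>lborel)"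
  proof (rule integral_dominated_convergence)
    show "integrable lborel (\<lambda>x. norm (G x))" using intG by simp
    show "AE x in lborel. (\<lambda>n. G x * exp (- (\<i> * of_real (x * t))) * of_real (w (\<sigma> n) x))
            \<longlonglongrightarrow> G x * exp (- (\<i> * of_real (x * t)))"
    proof (intro AE_I2)
      fix x
      have "(\<lambda>n. G x * exp (- (\<i> * of_real (x * t))) * of_real (w (\<sigma> n) x))
            \<longlonglongrightarrow> G x * exp (- (\<i> * of_real (x * t))) * of_real (w 0 x)"
        unfolding w_def by (intro tendsto_intros \<sigma>0) auto
      thus "(\<lambda>n. G x * exp (- (\<i> * of_real (x * t))) * of_real (w (\<sigma> n) x))
            \<longlonglongrightarrow> G x * exp (- (\<i> * of_real (x * t)))" by (simp add: w_def)
    qed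
    show "AE x in lborel. norm (G x * exp (- (\<i> * of_real (x * t))) * of_real (w (\<sigma> n) x)) \<le> norm (G x)" for n
      by (auto simp: norm_mult w_def mult_left_le)
  qed (auto simp: w_def)
  \<comment> \<open>Here continuity of f gives the pointwise limit, the bound B the dominating
    function, and the total mass 1 of the normal density the value f t.\<close>
  moreover have "(\<lambda>n. \<integral>u. f (t + \<sigma> n * u) * of_real (std_normal_density u) \<partial>lborel)
      \<longlonglongrightarrow> (\<integral>u. f t * of_real (std_normal_density u) \<partial>lborel)"
  proof (rule integral_dominated_convergence)
    show "integrable lborel (\<lambda>u. B * std_normal_density u)" by (intro integrable_mult_right) auto
    show "AE u in lborel. (\<lambda>n. f (t + \<sigma> n * u) * of_real (std_normal_density u)) \<longlonglongrightarrow> f t * of_real (std_normal_density u)"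
    proof (intro AE_I2 tendsto_intros)
      fix u
      have "(\<lambda>n. t + \<sigma> n * u) \<longlonglongrightarrow> t + 0 * u" by (intro tendsto_intros \<sigma>0)
      thus "(\<lambda>n. f (t + \<sigma> n * u)) \<longlonglongrightarrow> f t"
        by (intro continuous_on_tendsto_compose[OF cont]) auto
    qed
    show "AE u in lborel. norm (f (t + \<sigma> n * u) * of_real (std_normal_density u)) \<le> B * std_normal_density u" for n
      using bd by (auto simp: norm_mult intro!: mult_right_mono)
  qed auto
  hence "(\<lambda>n. 2 * pi * (\<integral>u. f (t + \<sigma> n * u) * of_real (std_normal_density u) \<partial>lborel)) \<longlonglongrightarrow> 2 * pi * f t"
    by (intro tendsto_mult tendsto_const) simp
  ultimately show ?thesis
    unfolding mollified[OF \<sigma>] by (rule LIMSEQ_unique)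
qed

section \<open>Decay of the Gamma function on vertical lines\<close>

text \<open>
  By Gauss' product, \<open>\<bar>\<Gamma>(s + i x)\<bar> / \<Gamma>(s)\<close> is a limit of products of the factors \<open>(s + j) / \<bar>s + j + i x\<bar>\<close>,
  each of which is increasing in \<open>s\<close>. This reduces the decay of \<open>\<Gamma>\<close> on a vertical line to
  half-integer abscissae, where the reflection formula gives it.
\<close>

lemma norm_Gamma_mono:
  fixes a c x :: real
  assumes "0 < a" "a \<le> c"
  shows "norm (Gamma (of_real a + \<i> * of_real x)) * Gamma c \<le> norm (Gamma (of_real c + \<i> * of_real x)) * Gamma a"
proof -
  \<comment> \<open>The power n^(i x) has modulus 1, so x enters only through the factors of the
    Pochhammer product.\<close>
  have norm_series: "norm (Gamma_series (of_real s + \<i> * of_real x) n)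
     = Gamma_series s n * (\<Prod>j=0..n. (s + real j) / norm (of_real (s + real j) + \<i> * of_real x))"
    if "s > 0" for s :: real and n
  proof -
    have "pochhammer s (Suc n) > 0" using that by (intro pochhammer_pos) auto
    hence "(\<Prod>j=0..n. s + real j) > 0" by (simp only: pochhammer_Suc_prod)
    thus ?thesis using that
      by (auto simp: Gamma_series_def norm_mult norm_divide pochhammer_Suc_prod prod_norm[symmetric]
                    prod_dividef add_ac)
  qed
  \<comment> \<open>After cross-multiplying and squaring, the common term in s and t cancels and
    only a comparison of (s x)^2 with (t x)^2 is left.\<close>
  have factor_mono: "s / norm (of_real s + \<i> * of_real x) \<le> t / norm (of_real t + \<i> * of_real x)"
    if "0 < s" "s \<le> t" for s t :: real
  proof -
    have "s\<^sup>2 * x\<^sup>2 \<le> t\<^sup>2 * x\<^sup>2" using that by (intro mult_right_mono power_mono) auto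
    hence "(s * sqrt (t\<^sup>2 + x\<^sup>2))\<^sup>2 \<le> (t * sqrt (s\<^sup>2 + x\<^sup>2))\<^sup>2"
      by (simp add: power_mult_distrib distrib_left mult.commute)
    hence "s * sqrt (t\<^sup>2 + x\<^sup>2) \<le> t * sqrt (s\<^sup>2 + x\<^sup>2)"
      by (rule power2_le_imp_le) (use that in simp)
    moreover have "sqrt (t\<^sup>2 + x\<^sup>2) > 0" "sqrt (s\<^sup>2 + x\<^sup>2) > 0"
      using that by (auto intro: add_pos_nonneg)
    ultimately show ?thesis
      by (simp add: cmod_def pos_divide_le_eq pos_le_divide_eq)
  qed
  have Gamma_series_nonneg: "Gamma_series s n \<ge> 0" if "s > 0" for s :: real and n
    unfolding Gamma_series_def using that by (intro divide_nonneg_nonneg mult_nonneg_nonneg pochhammer_nonneg) auto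
  have "norm (Gamma_series (of_real a + \<i> * of_real x) n) * Gamma_series c n
      \<le> norm (Gamma_series (of_real c + \<i> * of_real x) n) * Gamma_series a n" for n
  proof -
    have "(\<Prod>j=0..n. (a + real j) / norm (of_real (a + real j) + \<i> * of_real x))
        \<le> (\<Prod>j=0..n. (c + real j) / norm (of_real (c + real j) + \<i> * of_real x))"
      using assms by (intro prod_mono conjI factor_mono divide_nonneg_nonneg) auto
    from mult_left_mono[OF this, of "Gamma_series a n * Gamma_series c n"] show ?thesis
      using assms Gamma_series_nonneg by (simp add: norm_series mult_ac)
  qed
  moreover have lim: "(\<lambda>n. norm (Gamma_series (of_real s + \<i> * of_real x) n) * Gamma_series t n)
      \<longlonglongrightarrow> norm (Gamma (of_real s + \<i> * of_real x)) * Gamma t" for s t :: real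
    by (intro tendsto_intros)
  ultimately show ?thesis
    by (intro LIMSEQ_le[OF lim[of a c] lim[of c a]]) blast
qed

text \<open>On the line Re z = 1/2 one has 1 - z = cnj z, so the reflection formula computes the
  squared modulus: it is pi / cosh (pi x).\<close>

lemma norm_Gamma_half:
  fixes x :: real
  shows "norm (Gamma (1/2 + \<i> * of_real x)) \<le> sqrt (2 * pi) * exp (- (pi / 2 * \<bar>x\<bar>))"
proof -
  define y where "y = pi * x"
  have "Gamma (1/2 + \<i> * of_real x) * Gamma (1 - (1/2 + \<i> * of_real x)) = of_real pi / sin (of_real pi * (1/2 + \<i> * of_real x))"
    by (rule Gamma_reflection_complex)
  also have "1 - (1/2 + \<i> * of_real x) = cnj (1/2 + \<i> * of_real x)"
    by (simp add: complex_eq_iff)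
  also have "sin (of_real pi * (1/2 + \<i> * of_real x)) = cos (\<i> * of_real y)"
    using sin_cos_eq[of "of_real pi / 2 - \<i> * of_real y"]
    by (simp add: y_def algebra_simps sin_add)
  also have "Gamma (cnj (1/2 + \<i> * of_real x)) = cnj (Gamma (1/2 + \<i> * of_real x))"
    by (simp add: cnj_Gamma)
  also have "Gamma (1/2 + \<i> * of_real x) * cnj (Gamma (1/2 + \<i> * of_real x)) = of_real ((norm (Gamma (1/2 + \<i> * of_real x)))\<^sup>2)"
    by (rule complex_norm_square[symmetric])
  also have "cos (\<i> * of_real y) = of_real ((exp y + exp (- y)) / 2)"
    by (simp add: cos_exp_eq exp_of_real add.commute flip: mult.assoc of_real_minus of_real_add)
  finally have "of_real ((norm (Gamma (1/2 + \<i> * of_real x)))\<^sup>2) = complex_of_real (pi / ((exp y + exp (- y)) / 2))"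
    by simp
  hence "(norm (Gamma (1/2 + \<i> * of_real x)))\<^sup>2 = pi / ((exp y + exp (- y)) / 2)"
    by (simp only: of_real_eq_iff)
  also have "\<dots> \<le> pi / (exp \<bar>y\<bar> / 2)"
    by (intro divide_left_mono) (auto simp: abs_if add_pos_pos)
  also have "\<dots> = (sqrt (2 * pi) * exp (- (pi / 2 * \<bar>x\<bar>)))\<^sup>2"
    by (simp add: y_def abs_mult power_mult_distrib exp_minus divide_simps flip: exp_double)
  finally show ?thesis by (rule power2_le_imp_le) simp
qed

text \<open>Each use of Gamma (z + 1) = z Gamma z costs a factor linear in |x|, which is paid for
  with a part \<delta> of the exponential rate. The induction therefore needs all rates below pi / 2
  at once.\<close>

lemma norm_Gamma_half_integer_decay:
  fixes \<alpha> :: real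
  assumes "\<alpha> < pi / 2"
  shows "\<exists>C\<ge>0. \<forall>x::real. norm (Gamma (of_real (real n + 1/2) + \<i> * of_real x)) \<le> C * exp (- (\<alpha> * \<bar>x\<bar>))"
  using assms
proof (induction n arbitrary: \<alpha>)
  case 0
  show ?case
  proof (intro exI[of _ "sqrt (2 * pi)"] conjI allI)
    fix x :: real
    have "\<alpha> * \<bar>x\<bar> \<le> pi / 2 * \<bar>x\<bar>" using 0 by (intro mult_right_mono) auto
    hence "sqrt (2 * pi) * exp (- (pi / 2 * \<bar>x\<bar>)) \<le> sqrt (2 * pi) * exp (- (\<alpha> * \<bar>x\<bar>))" by simp
    from order.trans[OF norm_Gamma_half this]
    show "norm (Gamma (of_real (real 0 + 1/2) + \<i> * of_real x)) \<le> sqrt (2 * pi) * exp (- (\<alpha> * \<bar>x\<bar>))"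
      by simp
  qed auto
next
  case (Suc n)
  define \<delta> where "\<delta> = (pi / 2 - \<alpha>) / 2"
  have \<delta>: "\<delta> > 0" "\<alpha> + \<delta> < pi / 2" using Suc.prems by (auto simp: \<delta>_def field_simps)
  obtain C where C: "C \<ge> 0" "\<And>x. norm (Gamma (of_real (real n + 1/2) + \<i> * of_real x)) \<le> C * exp (- ((\<alpha> + \<delta>) * \<bar>x\<bar>))"
    using Suc.IH[OF \<delta>(2)] by blast
  show ?case
  proof (intro exI[of _ "(real n + 1/2 + 1 / \<delta>) * C"] conjI allI)
    show "(real n + 1/2 + 1 / \<delta>) * C \<ge> 0" using C \<delta> by simp
    fix x :: real
    define z where "z = of_real (real n + 1/2) + \<i> * of_real x"
    have "z \<noteq> 0" by (auto simp: z_def complex_eq_iff)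
    have "\<delta> * \<bar>x\<bar> \<le> exp (\<delta> * \<bar>x\<bar>)" using exp_ge_add_one_self[of "\<delta> * \<bar>x\<bar>"] by linarith
    hence x: "\<bar>x\<bar> \<le> 1 / \<delta> * exp (\<delta> * \<bar>x\<bar>)" using \<delta> by (simp add: field_simps)
    have "norm z \<le> norm (complex_of_real (real n + 1/2)) + norm (\<i> * of_real x)"
      unfolding z_def by (rule norm_triangle_ineq)
    also have "\<dots> = (real n + 1/2) + \<bar>x\<bar>"
      by (simp only: norm_mult norm_of_real norm_ii)
    also have "\<dots> \<le> (real n + 1/2) * exp (\<delta> * \<bar>x\<bar>) + 1 / \<delta> * exp (\<delta> * \<bar>x\<bar>)"
      using x \<delta> mult_left_mono[of 1 "exp (\<delta> * \<bar>x\<bar>)" "real n + 1/2"] by (intro add_mono) auto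
    finally have z: "norm z \<le> (real n + 1/2 + 1 / \<delta>) * exp (\<delta> * \<bar>x\<bar>)" by (simp only: distrib_right)
    have "norm (Gamma (z + 1)) = norm z * norm (Gamma z)"
      using \<open>z \<noteq> 0\<close> by (subst Gamma_plus1) (auto simp: norm_mult z_def complex_eq_iff elim!: nonpos_Ints_cases)
    also have "\<dots> \<le> ((real n + 1/2 + 1 / \<delta>) * exp (\<delta> * \<bar>x\<bar>)) * (C * exp (- ((\<alpha> + \<delta>) * \<bar>x\<bar>)))"
      using z C(2)[of x] \<delta> by (intro mult_mono) (auto simp: z_def)
    also have "\<dots> = (real n + 1/2 + 1 / \<delta>) * C * exp (- (\<alpha> * \<bar>x\<bar>))"
      by (simp add: algebra_simps exp_add exp_diff exp_minus)
    also have "z + 1 = of_real (real (Suc n) + 1/2) + \<i> * of_real x" by (simp add: z_def)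
    finally show "norm (Gamma (of_real (real (Suc n) + 1/2) + \<i> * of_real x)) \<le> (real n + 1/2 + 1 / \<delta>) * C * exp (- (\<alpha> * \<bar>x\<bar>))" .
  qed
qed

lemma norm_Gamma_decay:
  fixes \<alpha> a :: real
  assumes "a > 0" "\<alpha> < pi / 2"
  shows "\<exists>C\<ge>0. \<forall>x::real. norm (Gamma (of_real a + \<i> * of_real x)) \<le> C * exp (- (\<alpha> * \<bar>x\<bar>))"
proof -
  obtain n :: nat where n: "a \<le> real n" using real_arch_simple by blast
  define c where "c = real n + 1/2"
  have c: "a \<le> c" "c > 0" using n by (auto simp: c_def)
  obtain C where C: "C \<ge> 0" "\<And>x. norm (Gamma (of_real c + \<i> * of_real x)) \<le> C * exp (- (\<alpha> * \<bar>x\<bar>))"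
    using norm_Gamma_half_integer_decay[OF assms(2), of n] unfolding c_def by blast
  have G: "Gamma a > 0" "Gamma c > 0" using assms c by (auto intro: Gamma_real_pos)
  show ?thesis
  proof (intro exI[of _ "C * Gamma a / Gamma c"] conjI allI)
    fix x :: real
    have "norm (Gamma (of_real a + \<i> * of_real x)) * Gamma c \<le> C * exp (- (\<alpha> * \<bar>x\<bar>)) * Gamma a"
      using norm_Gamma_mono[OF assms(1) c(1), of x] mult_right_mono[OF C(2)[of x], of "Gamma a"] G by linarith
    thus "norm (Gamma (of_real a + \<i> * of_real x)) \<le> C * Gamma a / Gamma c * exp (- (\<alpha> * \<bar>x\<bar>))"
      using G by (simp add: field_simps)
  qed (use C G in auto)
qed

section \<open>Integrability of products of Gamma factors on vertical lines\<close>

lemma integrable_exp_minus_abs: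
  fixes \<epsilon> :: real
  assumes "\<epsilon> > 0"
  shows "integrable lborel (\<lambda>x::real. exp (- (\<epsilon> * \<bar>x\<bar>)))"
proof (rule Bochner_Integration.integrable_bound)
  \<comment> \<open>The beta integrand at z = w = \<epsilon> is (2 cosh (t / 2))^(- 2 \<epsilon>).
    Since cosh (t / 2) \<le> exp (|t| / 2), the constant 2^(2 \<epsilon>) makes it a
    majorant.\<close>
  show "integrable lborel (\<lambda>t::real. of_real (exp (2 * \<epsilon> * ln 2)) *
          exp (of_real \<epsilon> * of_real t - (of_real \<epsilon> + of_real \<epsilon>) * complex_of_real (ln (1 + exp t))))"
    using Beta_integral_exp[of "of_real \<epsilon>" "of_real \<epsilon>"] assms
    by (intro integrable_mult_right) (auto simp: has_bochner_integral_iff)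
  show "AE t in lborel. norm (exp (- (\<epsilon> * \<bar>t\<bar>))) \<le> norm (of_real (exp (2 * \<epsilon> * ln 2)) *
          exp (of_real \<epsilon> * of_real t - (of_real \<epsilon> + of_real \<epsilon>) * complex_of_real (ln (1 + exp t))))"
  proof (intro AE_I2)
    fix t :: real
    have "1 + exp t \<le> 2 * exp (max t 0)" by (auto simp: max_def)
    hence "ln (1 + exp t) \<le> ln (2 * exp (max t 0))" by (subst ln_le_cancel_iff) (auto simp: add_pos_pos)
    hence "ln (1 + exp t) \<le> ln 2 + max t 0" by (simp add: ln_mult)
    hence "- \<bar>t\<bar> \<le> 2 * ln 2 + t - 2 * ln (1 + exp t)" by (simp add: max_def abs_if split: if_splits)
    hence "\<epsilon> * (- \<bar>t\<bar>) \<le> \<epsilon> * (2 * ln 2 + t - 2 * ln (1 + exp t))" using assms by (intro mult_left_mono) auto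
    thus "norm (exp (- (\<epsilon> * \<bar>t\<bar>))) \<le> norm (of_real (exp (2 * \<epsilon> * ln 2)) *
          exp (of_real \<epsilon> * of_real t - (of_real \<epsilon> + of_real \<epsilon>) * complex_of_real (ln (1 + exp t))))"
      by (simp add: norm_mult algebra_simps flip: exp_add)
  qed
qed auto

lemma borel_measurable_Gamma_vertical:
  assumes "a > 0"
  shows "(\<lambda>x::real. Gamma (of_real a + \<i> * of_real x)) \<in> borel_measurable borel"
    and "(\<lambda>x::real. Gamma (of_real a - \<i> * of_real x)) \<in> borel_measurable borel"
  using assms
  by (auto intro!: borel_measurable_continuous_onI continuous_intros
        continuous_on_compose2[OF continuous_on_Gamma[of "{z. Re z > 0}"]] elim!: nonpos_Ints_cases)

lemma integrable_Gamma_Gamma_exp: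
  fixes a b \<theta> :: real
  assumes "a > 0" "b > 0" "\<theta> < pi"
  shows "integrable lborel (\<lambda>x::real. norm (Gamma (of_real a + \<i> * of_real x) * Gamma (of_real b - \<i> * of_real x)) * exp (\<theta> * \<bar>x\<bar>))"
proof -
  \<comment> \<open>The midpoint of \<theta> / 2 and pi / 2: admissible for each Gamma factor, while
    the two together decay at rate 2 \<alpha> > \<theta>.\<close>
  define \<alpha> where "\<alpha> = (pi + \<theta>) / 4"
  have \<alpha>: "\<alpha> < pi / 2" "2 * \<alpha> - \<theta> > 0" using assms(3) by (auto simp: \<alpha>_def)
  obtain C where C: "C \<ge> 0" "\<And>x. norm (Gamma (of_real a + \<i> * of_real x)) \<le> C * exp (- (\<alpha> * \<bar>x\<bar>))"
    using norm_Gamma_decay[OF assms(1) \<alpha>(1)] by blast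
  obtain D where D: "D \<ge> 0" "\<And>x. norm (Gamma (of_real b + \<i> * of_real x)) \<le> D * exp (- (\<alpha> * \<bar>x\<bar>))"
    using norm_Gamma_decay[OF assms(2) \<alpha>(1)] by blast
  show ?thesis
  proof (rule Bochner_Integration.integrable_bound)
    show "integrable lborel (\<lambda>x::real. C * D * exp (- ((2 * \<alpha> - \<theta>) * \<bar>x\<bar>)))"
      by (intro integrable_mult_right integrable_exp_minus_abs \<alpha>)
    show "AE x in lborel. norm (norm (Gamma (of_real a + \<i> * of_real x) * Gamma (of_real b - \<i> * of_real x)) * exp (\<theta> * \<bar>x\<bar>))
       \<le> norm (C * D * exp (- ((2 * \<alpha> - \<theta>) * \<bar>x\<bar>)))"
    proof (intro AE_I2)
      fix x :: real
      have "norm (Gamma (of_real a + \<i> * of_real x)) * norm (Gamma (of_real b + \<i> * of_real (- x))) * exp (\<theta> * \<bar>x\<bar>)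
         \<le> (C * exp (- (\<alpha> * \<bar>x\<bar>))) * (D * exp (- (\<alpha> * \<bar>- x\<bar>))) * exp (\<theta> * \<bar>x\<bar>)"
        using C D by (intro mult_mono C(2) D(2)) auto
      also have "\<dots> = C * D * exp (- ((2 * \<alpha> - \<theta>) * \<bar>x\<bar>))"
        by (simp add: algebra_simps flip: exp_add)
      finally show "norm (norm (Gamma (of_real a + \<i> * of_real x) * Gamma (of_real b - \<i> * of_real x)) * exp (\<theta> * \<bar>x\<bar>))
       \<le> norm (C * D * exp (- ((2 * \<alpha> - \<theta>) * \<bar>x\<bar>)))"
        using C D by (simp add: norm_mult)
    qed
    show "(\<lambda>x::real. norm (Gamma (of_real a + \<i> * of_real x) * Gamma (of_real b - \<i> * of_real x)) * exp (\<theta> * \<bar>x\<bar>)) \<in> borel_measurable lborel"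
      using borel_measurable_Gamma_vertical(1)[OF assms(1)] borel_measurable_Gamma_vertical(2)[OF assms(2)] by measurable
  qed
qed

text \<open>For z = a + i x and w = b - i x the sum z + w is independent of x. The beta integral is
  then the Fourier transform of one fixed function of s, and inversion applies.\<close>

lemma Gamma_Gamma_fourier_real:
  fixes a b t :: real
  assumes "a > 0" "b > 0"
  shows "(\<integral>x. Gamma (of_real a + \<i> * of_real x) * Gamma (of_real b - \<i> * of_real x) * exp (- (\<i> * of_real (x * t))) \<partial>lborel)
     = 2 * pi * Gamma (complex_of_real (a + b)) * of_real (exp (a * t - (a + b) * ln (1 + exp t)))"
proof -
  define f where "f = (\<lambda>s. complex_of_real (exp (a * s - (a + b) * ln (1 + exp s))))"
  define G where "G = (\<lambda>x::real. Gamma (of_real a + \<i> * of_real x) * Gamma (of_real b - \<i> * of_real x) / Gamma (of_real (a + b)))"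
  have pos: "1 + exp s \<noteq> (0::real)" for s :: real using exp_gt_zero[of s] by linarith
  have Gab: "Gamma (complex_of_real (a + b)) \<noteq> 0"
    using assms by (auto simp: Gamma_eq_zero_iff elim!: nonpos_Ints_cases dest!: arg_cong[where f = Re])
  have *: "has_bochner_integral lborel (\<lambda>s. f s * exp (\<i> * of_real (x * s))) (G x)" for x
    using Beta_integral_exp[of "of_real a + \<i> * of_real x" "of_real b - \<i> * of_real x"] assms
    by (simp add: f_def G_def algebra_simps flip: exp_add exp_of_real)
  have "(\<integral>x. G x * exp (- (\<i> * of_real (x * t))) \<partial>lborel) = 2 * pi * f t"
  proof (rule fourier_inversion)
    show "integrable lborel f" using *[of 0] by (simp add: has_bochner_integral_iff)
    show "continuous_on UNIV f" unfolding f_def by (intro continuous_intros) (auto simp: pos)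
    show "G x = (\<integral>s. f s * exp (\<i> * of_real (x * s)) \<partial>lborel)" for x
      using *[of x] by (simp add: has_bochner_integral_iff)
    have "integrable lborel (\<lambda>x. Gamma (of_real a + \<i> * of_real x) * Gamma (of_real b - \<i> * of_real x))"
      using borel_measurable_Gamma_vertical(1)[OF assms(1)] borel_measurable_Gamma_vertical(2)[OF assms(2)]
      by (intro Bochner_Integration.integrable_bound[OF integrable_Gamma_Gamma_exp[OF assms, of 0]]) auto
    thus "integrable lborel G" unfolding G_def by (rule integrable_divide)
    show "norm (f s) \<le> 1" for s
    proof -
      have "s \<le> ln (1 + exp s)" "0 \<le> ln (1 + exp s)"
        by (auto simp: ln_ge_iff add_pos_pos)
      hence "a * s \<le> a * ln (1 + exp s)" "0 \<le> b * ln (1 + exp s)" using assms by auto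
      thus ?thesis by (simp add: f_def algebra_simps)
    qed
  qed
  thus ?thesis using Gab by (simp add: G_def f_def field_simps)
qed

section \<open>Continuation to complex frequencies\<close>

lemma exp_notin_nonpos_Reals:
  fixes w :: complex
  assumes "\<bar>Im w\<bar> < pi"
  shows "exp w \<notin> \<real>\<^sub>\<le>\<^sub>0"
proof
  assume "exp w \<in> \<real>\<^sub>\<le>\<^sub>0"
  hence "sin (Im w) = 0" "cos (Im w) \<le> 0"
    by (auto simp: complex_nonpos_Reals_iff Re_exp Im_exp mult_le_0_iff)
  moreover have "Im w = 0" using assms \<open>sin (Im w) = 0\<close> by (metis abs_less_iff minus_less_iff sin_eq_0_pi)
  ultimately show False by simp
qed

lemma one_plus_exp_notin_nonpos_Reals:
  fixes w :: complex
  assumes "\<bar>Im w\<bar> < pi"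
  shows "1 + exp w \<notin> \<real>\<^sub>\<le>\<^sub>0"
  using exp_notin_nonpos_Reals[OF assms] by (auto simp: complex_nonpos_Reals_iff)

lemma Gamma_Gamma_laplace:
  fixes a b :: real and L :: complex
  assumes ab: "a > 0" "b > 0" and L: "\<bar>Im L\<bar> < pi"
  shows "has_bochner_integral lborel
    (\<lambda>x. Gamma (of_real a + \<i> * of_real x) * Gamma (of_real b - \<i> * of_real x) * exp (- (\<i> * of_real x * L)))
    (2 * pi * Gamma (complex_of_real (a + b)) * exp (of_real a * L - of_real (a + b) * Ln (1 + exp L)))"
proof -
  \<comment> \<open>The integral converges to a power series in \<open>h = L - Re L\<close> for \<open>\<bar>h\<bar> < \<pi>\<close>, and such discs with
    real centres cover the strip, so that the identity on the real axis suffices.\<close>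
  define t where "t = Re L"
  define g where "g = (\<lambda>x. Gamma (of_real a + \<i> * of_real x) * Gamma (of_real b - \<i> * of_real x) * exp (- (\<i> * of_real (x * t))))"
  define \<Phi> where "\<Phi> = (\<lambda>h::complex. \<integral>x. g x * exp (- (\<i> * of_real x * h)) \<partial>lborel)"
  define R where "R = (\<lambda>h::complex. 2 * pi * Gamma (complex_of_real (a + b)) *
     exp (of_real a * (of_real t + h) - of_real (a + b) * Ln (1 + exp (of_real t + h))))"
  define f where "f = (\<lambda>h (n::nat) x. g x * ((- (\<i> * of_real x * h)) ^ n / fact n))"
  have g_meas [measurable]: "g \<in> borel_measurable lborel"
    unfolding g_def using borel_measurable_Gamma_vertical(1)[OF ab(1)] borel_measurable_Gamma_vertical(2)[OF ab(2)]
    by measurable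
  \<comment> \<open>This single majorant serves the integral itself, every term of its expansion in
    h, and all partial sums.\<close>
  have dom: "integrable lborel (\<lambda>x. norm (g x) * exp (norm h * \<bar>x\<bar>))" if "norm h < pi" for h :: complex
    using integrable_Gamma_Gamma_exp[OF ab that] by (simp add: g_def norm_mult)
  have f_int: "integrable lborel (f h n)" if "norm h < pi" for h n
  proof (rule Bochner_Integration.integrable_bound[OF dom[OF that]])
    show "f h n \<in> borel_measurable lborel" unfolding f_def by measurable
    show "AE x in lborel. norm (f h n x) \<le> norm (norm (g x) * exp (norm h * \<bar>x\<bar>))"
    proof (intro AE_I2)
      fix x :: real
      have "(norm h * \<bar>x\<bar>) ^ n / fact n \<le> exp (norm h * \<bar>x\<bar>)"
        using sum_le_suminf[OF summable_exp_generic[of "norm h * \<bar>x\<bar>"], of "{n}"]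
        by (simp add: exp_def scaleR_conv_of_real field_simps)
      thus "norm (f h n x) \<le> norm (norm (g x) * exp (norm h * \<bar>x\<bar>))"
        using mult_left_mono[of "(norm h * \<bar>x\<bar>) ^ n / fact n" "exp (norm h * \<bar>x\<bar>)" "norm (g x)"]
        by (simp add: f_def norm_mult norm_power norm_divide mult.commute)
    qed
  qed
  have exp_int: "integrable lborel (\<lambda>x. g x * exp (- (\<i> * of_real x * h)))" if "norm h < pi" for h :: complex
  proof (rule Bochner_Integration.integrable_bound[OF dom[OF that]])
    show "AE x in lborel. norm (g x * exp (- (\<i> * of_real x * h))) \<le> norm (norm (g x) * exp (norm h * \<bar>x\<bar>))"
    proof (intro AE_I2)
      fix x :: real
      have "norm (exp (- (\<i> * of_real x * h))) \<le> exp (norm (- (\<i> * of_real x * h)))" by (rule norm_exp)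
      thus "norm (g x * exp (- (\<i> * of_real x * h))) \<le> norm (norm (g x) * exp (norm h * \<bar>x\<bar>))"
        by (auto simp: norm_mult mult.commute intro!: mult_left_mono)
    qed
  qed measurable
  have sums: "(\<lambda>n. (\<integral>x. f 1 n x \<partial>lborel) * h ^ n) sums \<Phi> h" if h: "norm h < pi" for h
  proof -
    have f_sums: "(\<lambda>n. f h n x) sums (g x * exp (- (\<i> * of_real x * h)))" for x
      unfolding f_def using exp_converges[of "- (\<i> * of_real x * h)"]
      by (intro sums_mult) (simp add: scaleR_conv_of_real field_simps)
    have f_norm_sums: "(\<lambda>n. norm (f h n x)) sums (norm (g x) * exp (norm h * \<bar>x\<bar>))" for x
    proof -
      have "(\<lambda>n. norm (g x) * ((norm h * \<bar>x\<bar>) ^ n /\<^sub>R fact n)) sums (norm (g x) * exp (norm h * \<bar>x\<bar>))"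
        by (intro sums_mult exp_converges)
      thus ?thesis by (simp add: f_def norm_mult norm_power norm_divide field_simps power_mult_distrib)
    qed
    \<comment> \<open>Partial sums of the exponential series of |h| |x| stay below exp (|h| |x|), so
      the integrals of the norms have bounded partial sums; this justifies termwise
      integration.\<close>
    have "summable (\<lambda>n. \<integral>x. norm (f h n x) \<partial>lborel)"
    proof (rule bounded_imp_summable)
      show "0 \<le> (\<integral>x. norm (f h n x) \<partial>lborel)" for n by simp
      fix n
      have "(\<Sum>k\<le>n. \<integral>x. norm (f h k x) \<partial>lborel) = (\<integral>x. (\<Sum>k\<le>n. norm (f h k x)) \<partial>lborel)"
        using f_int[OF h] by (subst Bochner_Integration.integral_sum) auto
      also have "\<dots> \<le> (\<integral>x. norm (g x) * exp (norm h * \<bar>x\<bar>) \<partial>lborel)"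
      proof (intro integral_mono dom[OF h])
        show "integrable lborel (\<lambda>x. \<Sum>k\<le>n. norm (f h k x))" using f_int[OF h] by auto
        show "(\<Sum>k\<le>n. norm (f h k x)) \<le> norm (g x) * exp (norm h * \<bar>x\<bar>)" for x
          using f_norm_sums[of x] by (metis finite_atMost norm_ge_zero sum_le_suminf sums_iff)
      qed
      finally show "(\<Sum>k\<le>n. \<integral>x. norm (f h k x) \<partial>lborel) \<le> (\<integral>x. norm (g x) * exp (norm h * \<bar>x\<bar>) \<partial>lborel)" .
    qed
    hence "(\<lambda>n. \<integral>x. f h n x \<partial>lborel) sums (\<integral>x. (\<Sum>n. f h n x) \<partial>lborel)"
      using f_norm_sums by (intro sums_integral f_int h AE_I2) (auto simp: sums_iff)
    moreover have "(\<Sum>n. f h n x) = g x * exp (- (\<i> * of_real x * h))" for x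
      using f_sums by (simp add: sums_iff)
    moreover have "(\<integral>x. f h n x \<partial>lborel) = (\<integral>x. f 1 n x \<partial>lborel) * h ^ n" for n
    proof -
      have "f h n x = f 1 n x * h ^ n" for x by (simp add: f_def power_mult_distrib power_minus[of "_ * _"])
      thus ?thesis by simp
    qed
    ultimately show ?thesis by (simp add: \<Phi>_def)
  qed
  have hol_\<Phi>: "\<Phi> holomorphic_on ball 0 pi"
    using sums by (intro power_series_holomorphic[where a = "\<lambda>n. \<integral>x. f 1 n x \<partial>lborel"]) auto
  have hol_R: "R holomorphic_on ball 0 pi"
  proof -
    have "1 + exp (of_real t + h) \<notin> \<real>\<^sub>\<le>\<^sub>0" if "h \<in> ball 0 pi" for h :: complex
      using that abs_Im_le_cmod[of h] by (intro one_plus_exp_notin_nonpos_Reals) auto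
    thus ?thesis unfolding R_def by (intro holomorphic_intros) auto
  qed
  have real: "\<Phi> (of_real r) - R (of_real r) = 0" for r :: real
  proof -
    have "\<Phi> (of_real r) = (\<integral>x. Gamma (of_real a + \<i> * of_real x) * Gamma (of_real b - \<i> * of_real x) * exp (- (\<i> * of_real (x * (t + r)))) \<partial>lborel)"
      unfolding \<Phi>_def g_def by (intro Bochner_Integration.integral_cong) (auto simp: algebra_simps simp flip: exp_add)
    also have "\<dots> = 2 * pi * Gamma (complex_of_real (a + b)) * of_real (exp (a * (t + r) - (a + b) * ln (1 + exp (t + r))))"
      by (rule Gamma_Gamma_fourier_real[OF ab])
    also have "\<dots> = R (of_real r)"
    proof -
      have e: "exp (of_real t + of_real r) = complex_of_real (exp (t + r))"
        by (simp only: exp_of_real of_real_add[symmetric])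
      have "Ln (complex_of_real (1 + exp (t + r))) = of_real (ln (1 + exp (t + r)))"
        by (rule Ln_of_real) (simp add: add_pos_pos)
      hence "of_real a * (of_real t + of_real r) - of_real (a + b) * Ln (1 + exp (of_real t + of_real r))
         = complex_of_real (a * (t + r) - (a + b) * ln (1 + exp (t + r)))"
        by (simp add: e)
      thus ?thesis by (simp only: R_def exp_of_real)
    qed
    finally show ?thesis by simp
  qed
  \<comment> \<open>The disc of radius pi about Re L contains L because |Im L| < pi. A real interval
    accumulating at its centre is enough for the identity theorem.\<close>
  have \<Phi>_R: "\<Phi> (\<i> * of_real (Im L)) - R (\<i> * of_real (Im L)) = 0"
  proof (rule analytic_continuation[of "\<lambda>h. \<Phi> h - R h" "ball 0 pi" "of_real ` {-1<..<1}" 0])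
    show "(\<lambda>h. \<Phi> h - R h) holomorphic_on ball 0 pi" by (intro holomorphic_intros hol_\<Phi> hol_R)
    show "complex_of_real ` {-1<..<1} \<subseteq> ball 0 pi" using pi_gt3 by auto
    show "0 islimpt complex_of_real ` {- 1<..<1}"
    proof (unfold islimpt_approachable, intro allI impI)
      fix e :: real assume "e > 0"
      define r where "r = min e 1 / 2"
      have "r \<in> {-1<..<1}" "r \<noteq> 0" "\<bar>r\<bar> < e" using \<open>e > 0\<close> by (auto simp: r_def)
      thus "\<exists>x'\<in>complex_of_real ` {- 1<..<1}. x' \<noteq> 0 \<and> dist x' 0 < e"
        by (intro bexI[of _ "of_real r"]) auto
    qed
    show "\<Phi> z - R z = 0" if "z \<in> complex_of_real ` {-1<..<1}" for z
      using that real by blast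
    show "\<i> * of_real (Im L) \<in> ball 0 pi" using L by (simp add: norm_mult)
  qed auto
  have "complex_of_real t + \<i> * of_real (Im L) = L" by (simp add: t_def complex_eq_iff)
  hence "R (\<i> * of_real (Im L)) = 2 * pi * Gamma (complex_of_real (a + b)) * exp (of_real a * L - of_real (a + b) * Ln (1 + exp L))"
    by (simp only: R_def)
  moreover have "has_bochner_integral lborel (\<lambda>x. g x * exp (- (\<i> * of_real x * (\<i> * of_real (Im L))))) (\<Phi> (\<i> * of_real (Im L)))"
    unfolding \<Phi>_def by (intro has_bochner_integral_integrable exp_int) (use L in \<open>simp add: norm_mult\<close>)
  ultimately have "has_bochner_integral lborel (\<lambda>x. g x * exp (- (\<i> * of_real x * (\<i> * of_real (Im L)))))
     (2 * pi * Gamma (complex_of_real (a + b)) * exp (of_real a * L - of_real (a + b) * Ln (1 + exp L)))"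
    using \<Phi>_R by (metis eq_iff_diff_eq_0)
  also have "(\<lambda>x. g x * exp (- (\<i> * of_real x * (\<i> * of_real (Im L))))) =
     (\<lambda>x. Gamma (of_real a + \<i> * of_real x) * Gamma (of_real b - \<i> * of_real x) * exp (- (\<i> * of_real x * L)))"
  proof
    fix x
    have "- (\<i> * of_real (x * t)) + - (\<i> * of_real x * (\<i> * of_real (Im L))) = - (\<i> * of_real x * L)"
      by (simp add: t_def complex_eq_iff)
    thus "g x * exp (- (\<i> * of_real x * (\<i> * of_real (Im L)))) =
       Gamma (of_real a + \<i> * of_real x) * Gamma (of_real b - \<i> * of_real x) * exp (- (\<i> * of_real x * L))"
      by (simp add: g_def mult.assoc flip: exp_add)
  qed
  finally show ?thesis .
qed

text \<open>To leave the strip, a path must meet |Im| = pi, where the exponential is a negative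
  real. Bounds on a logarithm are thus reduced to values of its exponential, which are
  explicit.\<close>

lemma abs_Im_less_pi_path:
  fixes g :: "real \<Rightarrow> complex"
  assumes cont: "continuous_on {0..1} g" and start: "\<bar>Im (g 0)\<bar> < pi"
    and avoid: "\<And>t. t \<in> {0..1} \<Longrightarrow> exp (g t) \<notin> \<real>\<^sub>\<le>\<^sub>0"
  shows "\<bar>Im (g 1)\<bar> < pi"
proof (rule ccontr)
  assume "\<not> \<bar>Im (g 1)\<bar> < pi"
  hence "\<exists>t\<ge>0. t \<le> 1 \<and> \<bar>Im (g t)\<bar> = pi"
    using start by (intro IVT' continuous_intros cont) auto
  then obtain t where t: "t \<in> {0..1}" "\<bar>Im (g t)\<bar> = pi" by auto
  hence "Im (g t) = pi \<or> Im (g t) = - pi" by linarith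
  hence "cos (Im (g t)) = -1" "sin (Im (g t)) = 0" by auto
  hence "exp (g t) \<in> \<real>\<^sub>\<le>\<^sub>0" by (simp add: complex_nonpos_Reals_iff Re_exp Im_exp)
  with avoid t show False by blast
qed

section \<open>The logarithm of the weight\<close>

lemma exp_ii_minus_conj:
  "exp (\<i> * of_real x) - exp (- (\<i> * of_real x)) = 2 * \<i> * of_real (sin x)"
  by (simp add: complex_eq_iff Re_exp Im_exp)

text \<open>The quotient is the exponential of the logarithm \<open>mp_log\<close> introduced below;
  here the full strength of the bound on \<rho> enters.\<close>

lemma rotated_quotient_notin_nonpos_Reals:
  fixes \<psi> \<phi> :: real and \<rho> :: complex
  assumes "sin \<psi> > 0" "sin \<phi> > 0"
    and small: "cmod \<rho> * (sin \<phi> + \<bar>sin (\<psi> - \<phi>)\<bar>) < sin \<psi>"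
    and nz: "1 - exp (\<i> * of_real \<phi>) * \<rho> \<noteq> 0"
  shows "- exp (2 * \<i> * of_real \<psi>) * (1 - exp (- \<i> * of_real \<phi>) * \<rho>) / (1 - exp (\<i> * of_real \<phi>) * \<rho>) \<notin> \<real>\<^sub>\<le>\<^sub>0"
proof
  assume "- exp (2 * \<i> * of_real \<psi>) * (1 - exp (- \<i> * of_real \<phi>) * \<rho>) / (1 - exp (\<i> * of_real \<phi>) * \<rho>) \<in> \<real>\<^sub>\<le>\<^sub>0"
  then obtain r where r: "r \<ge> 0"
    "- exp (2 * \<i> * of_real \<psi>) * (1 - exp (- \<i> * of_real \<phi>) * \<rho>) / (1 - exp (\<i> * of_real \<phi>) * \<rho>) = of_real (- r)"
    by (metis neg_0_le_iff_le nonpos_Reals_cases minus_minus)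
  define \<delta> where "\<delta> = \<psi> - \<phi>"
  define e where "e = (\<lambda>x::real. exp (\<i> * of_real x))"
  have e_add: "e (x + y) = e x * e y" for x y by (simp add: e_def distrib_left exp_add)
  have e_norm: "norm (e x) = 1" for x by (simp add: e_def)
  \<comment> \<open>Clearing the denominator and multiplying by exp (- i \<psi>) turns the equation
    with right side - r into X = \<rho> Y.\<close>
  define X where "X = e \<psi> - of_real r * e (- \<psi>)"
  define Y where "Y = e \<delta> - of_real r * e (- \<delta>)"
  have "exp (2 * \<i> * of_real \<psi>) * (1 - e (- \<phi>) * \<rho>) = of_real r * (1 - e \<phi> * \<rho>)"
    using r(2) nz by (simp add: e_def field_simps)
  also have "exp (2 * \<i> * of_real \<psi>) = e \<psi> * e \<psi>" by (simp add: e_def mult.assoc flip: exp_add)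
  finally have "e (- \<psi>) * (e \<psi> * e \<psi> * (1 - e (- \<phi>) * \<rho>)) = e (- \<psi>) * (of_real r * (1 - e \<phi> * \<rho>))"
    by simp
  moreover have "e (- \<psi>) * e \<psi> = 1" by (simp add: e_def flip: exp_add)
  ultimately have "e \<psi> * (1 - e (- \<phi>) * \<rho>) = of_real r * e (- \<psi>) * (1 - e \<phi> * \<rho>)"
    by (simp add: mult.assoc[symmetric])
  moreover have "e \<delta> = e \<psi> * e (- \<phi>)" "e (- \<delta>) = e (- \<psi>) * e \<phi>"
    by (simp_all add: \<delta>_def flip: e_add)
  ultimately have X_Y: "X = \<rho> * Y"
    by (simp add: X_def Y_def algebra_simps)
  have pythagoras: "cos \<psi> * (cos \<psi> * x) + x * (sin \<psi> * sin \<psi>) = x" for x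
  proof -
    have "cos \<psi> * (cos \<psi> * x) + x * (sin \<psi> * sin \<psi>) = x * ((sin \<psi>)\<^sup>2 + (cos \<psi>)\<^sup>2)"
      by (simp only: power2_eq_square distrib_left) (simp add: mult_ac)
    thus ?thesis by simp
  qed
  \<comment> \<open>\<open>X\<close> is at least \<open>\<bar>1 - r\<bar>\<close>, so \<open>sin \<psi> \<bar>Y\<bar> \<le> (\<bar>sin \<delta>\<bar> + sin \<phi>) \<bar>X\<bar>\<close>, which with \<open>X = \<rho> Y\<close>
    contradicts the hypothesis on \<open>\<rho>\<close>.\<close>
  have "of_real (sin \<psi>) * e \<delta> = of_real (sin \<delta>) * e \<psi> + of_real (sin \<phi>)"
    "of_real (sin \<psi>) * e (- \<delta>) = of_real (sin \<delta>) * e (- \<psi>) + of_real (sin \<phi>)"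
    by (simp_all add: complex_eq_iff e_def Re_exp Im_exp \<delta>_def sin_diff cos_diff algebra_simps pythagoras)
  \<comment> \<open>The coefficients sin \<delta> and sin \<phi> are real, so the two identities are
    conjugate; combining them with weights 1 and - r produces X on the right.\<close>
  hence Y: "of_real (sin \<psi>) * Y = of_real (sin \<delta>) * X + of_real (sin \<phi> * (1 - r))"
    unfolding Y_def X_def right_diff_distrib mult.left_commute[of "of_real (sin \<psi>)" "of_real r"]
    by (simp add: algebra_simps)
  have X_ge: "\<bar>1 - r\<bar> \<le> norm X"
    using norm_triangle_ineq3[of "e \<psi>" "of_real r * e (- \<psi>)"] r(1) by (simp add: X_def norm_mult e_norm)
  have "X \<noteq> 0"
  proof
    assume "X = 0"
    with X_ge have "r = 1" by simp
    with \<open>X = 0\<close> exp_ii_minus_conj[of \<psi>] assms(1) show False by (simp add: X_def e_def)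
  qed
  have "sin \<psi> * norm X = norm \<rho> * norm (of_real (sin \<psi>) * Y)"
    using assms(1) by (simp add: X_Y norm_mult)
  also have "norm (of_real (sin \<psi>) * Y) \<le> \<bar>sin \<delta>\<bar> * norm X + sin \<phi> * norm X"
    unfolding Y by (rule order.trans[OF norm_triangle_ineq])
      (use assms X_ge in \<open>simp add: norm_mult mult_left_mono del: of_real_mult of_real_diff add: abs_mult\<close>)
  hence "norm \<rho> * norm (of_real (sin \<psi>) * Y) \<le> norm \<rho> * (\<bar>sin \<delta>\<bar> * norm X + sin \<phi> * norm X)"
    by (rule mult_left_mono) simp
  also have "\<dots> = (norm \<rho> * (sin \<phi> + \<bar>sin \<delta>\<bar>)) * norm X" by (simp add: algebra_simps)
  also have "\<dots> < sin \<psi> * norm X"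
    using small \<open>X \<noteq> 0\<close> by (intro mult_strict_right_mono) (auto simp: \<delta>_def)
  finally show False by simp
qed

text \<open>
  The logarithm \<open>L\<close> for which the product of the two powers and \<open>exp ((2 \<psi> - \<pi>) x)\<close> depends on \<open>x\<close>
  through \<open>exp (- i x L)\<close>.
\<close>

definition mp_log :: "real \<Rightarrow> real \<Rightarrow> complex \<Rightarrow> complex" where
  "mp_log \<psi> \<phi> \<rho> = \<i> * of_real (2 * \<psi> - pi) + Ln (1 - exp (- \<i> * of_real \<phi>) * \<rho>) - Ln (1 - exp (\<i> * of_real \<phi>) * \<rho>)"

lemma one_minus_unit_notin_nonpos_Reals:
  fixes z w :: complex
  assumes "norm z = 1" "norm w < 1"
  shows "1 - z * w \<notin> \<real>\<^sub>\<le>\<^sub>0"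
proof -
  have "Re (z * w) < 1" using complex_Re_le_cmod[of "z * w"] assms by (simp add: norm_mult)
  thus ?thesis by (auto simp: complex_nonpos_Reals_iff)
qed

section \<open>Principal logarithms under the hypothesis on \<rho>\<close>

context
  fixes \<psi> \<phi> :: real
  assumes \<psi>: "\<psi> \<in> {0<..<pi}" and \<phi>: "\<phi> \<in> {0<..<pi}"
begin

private lemma sin_pos: "sin \<psi> > 0" "sin \<phi> > 0"
  using \<psi> \<phi> by (auto intro: sin_gt_zero)

private lemma norm_lt_1:
  assumes "cmod \<rho> * (sin \<phi> + \<bar>sin (\<psi> - \<phi>)\<bar>) < sin \<psi>"
  shows "cmod \<rho> < 1"
proof -
  have "sin \<psi> = sin \<phi> * cos (\<psi> - \<phi>) + cos \<phi> * sin (\<psi> - \<phi>)"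
    using sin_add[of \<phi> "\<psi> - \<phi>"] by simp
  also have "\<dots> \<le> \<bar>sin \<phi> * cos (\<psi> - \<phi>)\<bar> + \<bar>cos \<phi> * sin (\<psi> - \<phi>)\<bar>" by linarith
  also have "\<dots> \<le> \<bar>sin \<phi>\<bar> * 1 + 1 * \<bar>sin (\<psi> - \<phi>)\<bar>"
    unfolding abs_mult by (intro add_mono mult_left_mono mult_right_mono) auto
  finally have "sin \<psi> \<le> sin \<phi> + \<bar>sin (\<psi> - \<phi>)\<bar>" using sin_pos by simp
  from less_le_trans[OF assms this]
  have "cmod \<rho> * (sin \<phi> + \<bar>sin (\<psi> - \<phi>)\<bar>) < 1 * (sin \<phi> + \<bar>sin (\<psi> - \<phi>)\<bar>)" by simp
  thus ?thesis by (rule mult_right_less_imp_less) (use sin_pos in simp)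
qed

text \<open>Each subtracted term has modulus below 1, so all three numbers have positive real part
  and their principal logarithms are continuous in \<rho>.\<close>

private lemma factors_notin_nonpos_Reals:
  assumes "cmod \<rho> * (sin \<phi> + \<bar>sin (\<psi> - \<phi>)\<bar>) < sin \<psi>"
  shows "1 - exp (\<i> * of_real \<phi>) * \<rho> \<notin> \<real>\<^sub>\<le>\<^sub>0" "1 - exp (- \<i> * of_real \<phi>) * \<rho> \<notin> \<real>\<^sub>\<le>\<^sub>0"
    "1 - of_real (sin (\<psi> - \<phi>) / sin \<psi>) * \<rho> \<notin> \<real>\<^sub>\<le>\<^sub>0"
proof -
  show "1 - exp (\<i> * of_real \<phi>) * \<rho> \<notin> \<real>\<^sub>\<le>\<^sub>0" "1 - exp (- \<i> * of_real \<phi>) * \<rho> \<notin> \<real>\<^sub>\<le>\<^sub>0"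
    using norm_lt_1[OF assms] by (intro one_minus_unit_notin_nonpos_Reals; simp)+
  have "cmod \<rho> * \<bar>sin (\<psi> - \<phi>)\<bar> \<le> cmod \<rho> * (sin \<phi> + \<bar>sin (\<psi> - \<phi>)\<bar>)"
    using sin_pos by (intro mult_left_mono) auto
  hence "norm (of_real (sin (\<psi> - \<phi>) / sin \<psi>) * \<rho>) < 1"
    using assms sin_pos by (simp add: norm_mult norm_divide mult.commute)
  from one_minus_unit_notin_nonpos_Reals[OF norm_one this]
  show "1 - of_real (sin (\<psi> - \<phi>) / sin \<psi>) * \<rho> \<notin> \<real>\<^sub>\<le>\<^sub>0" by simp
qed

text \<open>
  Identities between principal logarithms hold at \<open>\<rho> = 0\<close> and are carried along the segment
  from \<open>0\<close> to \<open>\<rho>\<close>, on which the hypothesis on \<open>\<rho>\<close> persists.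
\<close>

private lemma small_scaled:
  assumes "cmod \<rho> * (sin \<phi> + \<bar>sin (\<psi> - \<phi>)\<bar>) < sin \<psi>" "t \<in> {0..1}"
  shows "cmod (of_real t * \<rho>) * (sin \<phi> + \<bar>sin (\<psi> - \<phi>)\<bar>) < sin \<psi>"
proof -
  have "t * (cmod \<rho> * (sin \<phi> + \<bar>sin (\<psi> - \<phi>)\<bar>)) \<le> 1 * (cmod \<rho> * (sin \<phi> + \<bar>sin (\<psi> - \<phi>)\<bar>))"
    using assms(2) sin_pos by (intro mult_right_mono) auto
  thus ?thesis using assms by (simp add: norm_mult mult.assoc)
qed

private lemma exp_mp_log:
  assumes "cmod \<rho> * (sin \<phi> + \<bar>sin (\<psi> - \<phi>)\<bar>) < sin \<psi>"
  shows "exp (mp_log \<psi> \<phi> \<rho>) = - exp (2 * \<i> * of_real \<psi>) * (1 - exp (- \<i> * of_real \<phi>) * \<rho>) / (1 - exp (\<i> * of_real \<phi>) * \<rho>)"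
proof -
  have "exp (\<i> * of_real (2 * \<psi> - pi)) = - exp (2 * \<i> * of_real \<psi>)"
    by (simp add: right_diff_distrib exp_diff mult_ac)
  moreover have "1 - exp (\<i> * of_real \<phi>) * \<rho> \<noteq> 0" "1 - exp (- \<i> * of_real \<phi>) * \<rho> \<noteq> 0"
    using factors_notin_nonpos_Reals[OF assms] by force+
  ultimately show ?thesis by (simp add: mp_log_def exp_add exp_diff)
qed

lemma abs_Im_mp_log_less_pi:
  assumes "cmod \<rho> * (sin \<phi> + \<bar>sin (\<psi> - \<phi>)\<bar>) < sin \<psi>"
  shows "\<bar>Im (mp_log \<psi> \<phi> \<rho>)\<bar> < pi"
proof -
  have "\<bar>Im (mp_log \<psi> \<phi> (of_real 1 * \<rho>))\<bar> < pi"
  proof (rule abs_Im_less_pi_path)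
    show "continuous_on {0..1} (\<lambda>t. mp_log \<psi> \<phi> (of_real t * \<rho>))"
      unfolding mp_log_def using factors_notin_nonpos_Reals[OF small_scaled[OF assms]]
      by (intro continuous_intros) auto
    \<comment> \<open>At \<rho> = 0 the logarithm is i (2 \<psi> - pi), and 0 < \<psi> < pi.\<close>
    show "\<bar>Im (mp_log \<psi> \<phi> (of_real 0 * \<rho>))\<bar> < pi"
      using \<psi> by (auto simp: mp_log_def)
    show "exp (mp_log \<psi> \<phi> (of_real t * \<rho>)) \<notin> \<real>\<^sub>\<le>\<^sub>0" if t: "t \<in> {0..1}" for t
      unfolding exp_mp_log[OF small_scaled[OF assms t]]
      using factors_notin_nonpos_Reals(1)[OF small_scaled[OF assms t]]
      by (intro rotated_quotient_notin_nonpos_Reals sin_pos small_scaled[OF assms t]) auto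
  qed
  thus ?thesis by simp
qed

private lemma exp_ii_mult_sum:
  "exp (- \<i> * of_real \<phi>) * of_real (sin \<psi>) = of_real (sin (\<psi> - \<phi>)) + of_real (sin \<phi>) * exp (- \<i> * of_real \<psi>)"
  by (simp add: complex_eq_iff Re_exp Im_exp sin_diff algebra_simps)

text \<open>Over the common denominator, taking out - exp (i \<psi>) leaves differences of conjugate
  exponentials, that is, 2 i times sines.\<close>

private lemma one_plus_exp_mp_log:
  assumes "cmod \<rho> * (sin \<phi> + \<bar>sin (\<psi> - \<phi>)\<bar>) < sin \<psi>"
  shows "1 + exp (mp_log \<psi> \<phi> \<rho>) = - 2 * \<i> * exp (\<i> * of_real \<psi>) * of_real (sin \<psi>) *
     (1 - of_real (sin (\<psi> - \<phi>) / sin \<psi>) * \<rho>) / (1 - exp (\<i> * of_real \<phi>) * \<rho>)"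
proof -
  have "1 - exp (\<i> * of_real \<phi>) * \<rho> \<noteq> 0" using factors_notin_nonpos_Reals(1)[OF assms] by force
  hence "1 + exp (mp_log \<psi> \<phi> \<rho>) = ((1 - exp (\<i> * of_real \<phi>) * \<rho>) - exp (2 * \<i> * of_real \<psi>) * (1 - exp (- \<i> * of_real \<phi>) * \<rho>)) / (1 - exp (\<i> * of_real \<phi>) * \<rho>)"
    unfolding exp_mp_log[OF assms] by (simp add: field_simps)
  also have "(1 - exp (\<i> * of_real \<phi>) * \<rho>) - exp (2 * \<i> * of_real \<psi>) * (1 - exp (- \<i> * of_real \<phi>) * \<rho>)
     = - exp (\<i> * of_real \<psi>) * ((exp (\<i> * of_real \<psi>) - exp (- (\<i> * of_real \<psi>)))
         - (exp (\<i> * of_real (\<psi> - \<phi>)) - exp (- (\<i> * of_real (\<psi> - \<phi>)))) * \<rho>)"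
  proof -
    have expand: "- a * ((a - b) - (c - d) * r) = a * b - a * a + (a * c) * r - (a * d) * r" for a b c d r :: complex
      by (simp add: algebra_simps)
    have prods: "exp (\<i> * of_real \<psi>) * exp (\<i> * of_real \<psi>) = exp (2 * \<i> * of_real \<psi>)"
      "exp (\<i> * of_real \<psi>) * exp (- (\<i> * of_real \<psi>)) = 1"
      "exp (\<i> * of_real \<psi>) * exp (\<i> * of_real (\<psi> - \<phi>)) = exp (2 * \<i> * of_real \<psi>) * exp (- \<i> * of_real \<phi>)"
      "exp (\<i> * of_real \<psi>) * exp (- (\<i> * of_real (\<psi> - \<phi>))) = exp (\<i> * of_real \<phi>)"
      by (simp_all add: algebra_simps flip: exp_add)
    show ?thesis unfolding expand prods by (simp add: algebra_simps)
  qed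
  also have "\<dots> = - 2 * \<i> * exp (\<i> * of_real \<psi>) * of_real (sin \<psi>) * (1 - of_real (sin (\<psi> - \<phi>) / sin \<psi>) * \<rho>)"
    unfolding exp_ii_minus_conj using sin_pos by (simp add: field_simps)
  finally show ?thesis .
qed

text \<open>The right side is visibly some logarithm of 1 + e^L. It is the principal one because 1 +
  e^L avoids the nonpositive reals along the segment, thanks to the strip bound for L.\<close>

private lemma Ln_one_plus_exp_mp_log:
  assumes "cmod \<rho> * (sin \<phi> + \<bar>sin (\<psi> - \<phi>)\<bar>) < sin \<psi>"
  shows "Ln (1 + exp (mp_log \<psi> \<phi> \<rho>)) = \<i> * of_real (\<psi> - pi / 2) + of_real (ln (2 * sin \<psi>))
     + Ln (1 - of_real (sin (\<psi> - \<phi>) / sin \<psi>) * \<rho>) - Ln (1 - exp (\<i> * of_real \<phi>) * \<rho>)"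
proof -
  \<comment> \<open>The constants come from - 2 i exp (i \<psi>) sin \<psi> = exp (i (\<psi> - pi /
    2)) * 2 sin \<psi>; at \<rho> = 0 the imaginary part is \<psi> - pi / 2.\<close>
  define M where "M = (\<lambda>\<rho>. \<i> * of_real (\<psi> - pi / 2) + of_real (ln (2 * sin \<psi>))
     + Ln (1 - of_real (sin (\<psi> - \<phi>) / sin \<psi>) * \<rho>) - Ln (1 - exp (\<i> * of_real \<phi>) * \<rho>))"
  have exp_M: "exp (M \<rho>) = 1 + exp (mp_log \<psi> \<phi> \<rho>)"
    if "cmod \<rho> * (sin \<phi> + \<bar>sin (\<psi> - \<phi>)\<bar>) < sin \<psi>" for \<rho>
  proof -
    have "exp (\<i> * of_real (\<psi> - pi / 2)) = - \<i> * exp (\<i> * of_real \<psi>)"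
      using cis_pi_half by (simp add: right_diff_distrib exp_diff cis_conv_exp)
    moreover have "exp (of_real (ln (2 * sin \<psi>))) = complex_of_real (2 * sin \<psi>)"
      using sin_pos by (simp add: exp_of_real)
    moreover have "1 - of_real (sin (\<psi> - \<phi>) / sin \<psi>) * \<rho> \<noteq> 0" "1 - exp (\<i> * of_real \<phi>) * \<rho> \<noteq> 0"
      using factors_notin_nonpos_Reals[OF that] by force+
    ultimately show ?thesis
      unfolding M_def one_plus_exp_mp_log[OF that] exp_add exp_diff by simp
  qed
  have "\<bar>Im (M (of_real 1 * \<rho>))\<bar> < pi"
  proof (rule abs_Im_less_pi_path)
    show "continuous_on {0..1} (\<lambda>t. M (of_real t * \<rho>))"
      unfolding M_def using factors_notin_nonpos_Reals[OF small_scaled[OF assms]]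
      by (intro continuous_intros) auto
    show "\<bar>Im (M (of_real 0 * \<rho>))\<bar> < pi"
      using \<psi> by (auto simp: M_def)
    show "exp (M (of_real t * \<rho>)) \<notin> \<real>\<^sub>\<le>\<^sub>0" if t: "t \<in> {0..1}" for t
      unfolding exp_M[OF small_scaled[OF assms t]]
      by (intro one_plus_exp_notin_nonpos_Reals abs_Im_mp_log_less_pi small_scaled[OF assms t])
  qed
  hence "Ln (exp (M \<rho>)) = M \<rho>" by (intro Ln_exp) auto
  thus ?thesis unfolding exp_M[OF assms] by (simp add: M_def)
qed

lemma mp_log_quotient:
  assumes "cmod \<rho> * (sin \<phi> + \<bar>sin (\<psi> - \<phi>)\<bar>) < sin \<psi>"
  shows "1 - (1 - exp (- 2 * \<i> * of_real \<psi>)) * (exp (mp_log \<psi> \<phi> \<rho>) / (1 + exp (mp_log \<psi> \<phi> \<rho>)))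
     = exp (- \<i> * of_real \<psi>) * (\<rho> * of_real (sin \<phi>) / (of_real (sin \<psi>) - \<rho> * of_real (sin (\<psi> - \<phi>))))"
proof -
  define A where "A = 1 - exp (\<i> * of_real \<phi>) * \<rho>"
  define B where "B = 1 - exp (- \<i> * of_real \<phi>) * \<rho>"
  define S where "S = of_real (sin \<psi>) - \<rho> * of_real (sin (\<psi> - \<phi>))"
  define s where "s = complex_of_real (sin \<psi>)"
  define E where "E = exp (\<i> * of_real \<psi>)"
  have R: "1 - of_real (sin (\<psi> - \<phi>) / sin \<psi>) * \<rho> = S / s"
    using sin_pos by (simp add: S_def s_def field_simps)
  have nz: "A \<noteq> 0" "S \<noteq> 0" "s \<noteq> 0" "E \<noteq> 0"
    using factors_notin_nonpos_Reals[OF assms] sin_pos unfolding R by (auto simp: A_def s_def E_def)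
  have E2: "exp (2 * \<i> * of_real \<psi>) = E * E" by (simp add: E_def mult.assoc flip: exp_add)
  have L: "exp (mp_log \<psi> \<phi> \<rho>) = - (E * E) * B / A"
    unfolding exp_mp_log[OF assms] A_def B_def E2 by simp
  have L1: "1 + exp (mp_log \<psi> \<phi> \<rho>) = - 2 * \<i> * E * S / A"
    unfolding one_plus_exp_mp_log[OF assms] R using nz by (simp add: A_def E_def s_def)
  have "(1 - exp (- 2 * \<i> * of_real \<psi>)) = inverse E * (2 * \<i> * s)"
  proof -
    have "inverse E * (E - inverse E) = 1 - exp (- 2 * \<i> * of_real \<psi>)"
      by (simp add: E_def right_diff_distrib mult.assoc flip: exp_minus exp_add)
    thus ?thesis using exp_ii_minus_conj[of \<psi>] by (simp add: E_def s_def exp_minus)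
  qed
  hence "1 - (1 - exp (- 2 * \<i> * of_real \<psi>)) * (exp (mp_log \<psi> \<phi> \<rho>) / (1 + exp (mp_log \<psi> \<phi> \<rho>)))
     = 1 - inverse E * (2 * \<i> * s) * (- (E * E) * B / A / (- 2 * \<i> * E * S / A))"
    unfolding L1 unfolding L by (simp only:)
  also have "\<dots> = (S - s * B) / S"
    using nz by (simp add: field_simps)
  \<comment> \<open>The constant terms sin \<psi> cancel, and \<open>exp_ii_mult_sum\<close> removes
    sin (\<psi> - \<phi>), leaving sin \<phi> alone.\<close>
  also have "S - s * B = of_real (sin \<phi>) * exp (- \<i> * of_real \<psi>) * \<rho>"
  proof -
    have "s * B = s - (exp (- \<i> * of_real \<phi>) * of_real (sin \<psi>)) * \<rho>" by (simp add: B_def s_def algebra_simps)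
    thus ?thesis unfolding exp_ii_mult_sum by (simp add: S_def s_def algebra_simps)
  qed
  finally show ?thesis by (simp add: S_def mult_ac)
qed

lemma mp_weight:
  fixes lam x :: real
  assumes "cmod \<rho> * (sin \<phi> + \<bar>sin (\<psi> - \<phi>)\<bar>) < sin \<psi>"
  shows "(1 - exp (\<i> * of_real \<phi>) * \<rho>) powr (- of_real lam + \<i> * of_real x)
       * (1 - exp (- \<i> * of_real \<phi>) * \<rho>) powr (- of_real lam - \<i> * of_real x)
       * of_real (exp ((2 * \<psi> - pi) * x))
     = exp (- of_real lam * (Ln (1 - exp (\<i> * of_real \<phi>) * \<rho>) + Ln (1 - exp (- \<i> * of_real \<phi>) * \<rho>)))
       * exp (- (\<i> * of_real x * mp_log \<psi> \<phi> \<rho>))"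
proof -
  have nz: "1 - exp (\<i> * of_real \<phi>) * \<rho> \<noteq> 0" "1 - exp (- \<i> * of_real \<phi>) * \<rho> \<noteq> 0"
    using factors_notin_nonpos_Reals[OF assms] by force+
  have "(- of_real lam + \<i> * of_real x) * u + (- of_real lam - \<i> * of_real x) * v + of_real ((2 * \<psi> - pi) * x)
     = - of_real lam * (u + v) + - (\<i> * of_real x * (\<i> * of_real (2 * \<psi> - pi) + v - u))" for u v
    by (simp add: algebra_simps)
  thus ?thesis
    using nz unfolding powr_def mp_log_def
    by (simp only: if_False exp_of_real[symmetric] exp_add[symmetric])
qed

text \<open>With u, v for the logarithms of the two weight factors, - lam (u + v) + lam (v - u) + 2
  lam u = 0, and lam (2 \<psi> - pi) = 2 lam (\<psi> - pi / 2). Only the logarithm of the third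
  factor and ln (2 sin \<psi>) survive.\<close>

lemma mp_prefactor:
  fixes lam :: real
  assumes "cmod \<rho> * (sin \<phi> + \<bar>sin (\<psi> - \<phi>)\<bar>) < sin \<psi>"
  shows "exp (- of_real lam * (Ln (1 - exp (\<i> * of_real \<phi>) * \<rho>) + Ln (1 - exp (- \<i> * of_real \<phi>) * \<rho>)))
       * exp (of_real lam * mp_log \<psi> \<phi> \<rho> - of_real (2 * lam) * Ln (1 + exp (mp_log \<psi> \<phi> \<rho>)))
     = (1 - \<rho> * of_real (sin (\<psi> - \<phi>) / sin \<psi>)) powr (- 2 * of_real lam) / of_real ((2 * sin \<psi>) powr (2 * lam))"
proof -
  define R where "R = 1 - of_real (sin (\<psi> - \<phi>) / sin \<psi>) * \<rho>"
  have "R \<noteq> 0" using factors_notin_nonpos_Reals(3)[OF assms] by (auto simp: R_def)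
  have "- of_real lam * (u + v) + (of_real lam * (\<i> * of_real (2 * \<psi> - pi) + v - u)
      - of_real (2 * lam) * (\<i> * of_real (\<psi> - pi / 2) + c + w - u)) = - 2 * of_real lam * w - of_real (2 * lam) * c" for u v w c
    by (simp add: algebra_simps)
  hence "exp (- of_real lam * (Ln (1 - exp (\<i> * of_real \<phi>) * \<rho>) + Ln (1 - exp (- \<i> * of_real \<phi>) * \<rho>)))
       * exp (of_real lam * mp_log \<psi> \<phi> \<rho> - of_real (2 * lam) * Ln (1 + exp (mp_log \<psi> \<phi> \<rho>)))
     = exp (- 2 * of_real lam * Ln R - of_real (2 * lam) * of_real (ln (2 * sin \<psi>)))"
    unfolding Ln_one_plus_exp_mp_log[OF assms] unfolding mp_log_def R_def[symmetric]
    by (simp only: exp_add[symmetric])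
  also have "\<dots> = R powr (- 2 * of_real lam) / of_real ((2 * sin \<psi>) powr (2 * lam))"
    using \<open>R \<noteq> 0\<close> sin_pos by (simp add: powr_def exp_diff exp_of_real[symmetric])
  finally show ?thesis by (simp add: R_def mult.commute)
qed

end

section \<open>Termwise integration of the polynomial\<close>

lemma sum_pochhammer_neg:
  fixes y :: complex
  shows "(\<Sum>n\<le>k. pochhammer (- of_nat k) n / fact n * y ^ n) = (1 - y) ^ k"
proof -
  have "pochhammer (- of_nat k) n / fact n = (-1) ^ n * complex_of_nat (k choose n)" for n
    by (simp add: binomial_gbinomial gbinomial_pochhammer flip: power_mult_distrib)
  moreover have "(1 - y) ^ k = (\<Sum>n\<le>k. of_nat (k choose n) * (- y) ^ n * 1 ^ (k - n))"
    using binomial_ring[of "- y" 1 k] by simp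
  ultimately show ?thesis by (simp add: power_minus[of y] mult_ac)
qed

lemma meixner_pollaczek_eq_sum:
  "meixner_pollaczek k lam x \<psi> = pochhammer (2 * of_real lam) k / fact k * exp (\<i> * of_nat k * of_real \<psi>)
     * (\<Sum>n\<le>k. pochhammer (- of_nat k) n / fact n * (1 - exp (- 2 * \<i> * of_real \<psi>)) ^ n
          * pochhammer (of_real lam + \<i> * of_real x) n / pochhammer (2 * of_real lam) n)"
proof -
  have "hyp2F1 (- of_nat k) a b z = (\<Sum>n\<le>k. pochhammer (- of_nat k) n / fact n * z ^ n * pochhammer a n / pochhammer b n)" for a b z
    unfolding hyp2F1_def
    by (subst suminf_finite[of "{..k}"]) (auto simp: pochhammer_of_nat_eq_0_iff mult_ac intro!: sum.cong)
  thus ?thesis by (simp add: meixner_pollaczek_def)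
qed

theorem corollary6p8:
  fixes k :: nat and lam \<psi> \<phi> :: real and \<rho> :: complex
  assumes "lam > 0"
    and "\<psi> \<in> {0<..<pi}"
    and "\<phi> \<in> {0<..<pi}"
    and "cmod \<rho> * (sin \<phi> + \<bar>sin (\<psi> - \<phi>)\<bar>) < sin \<psi>"
  shows "has_bochner_integral lborel
    (\<lambda>x::real.
       (1 - exp (\<i> * of_real \<phi>) * \<rho>) powr (- of_real lam + \<i> * of_real x)
       * (1 - exp (- \<i> * of_real \<phi>) * \<rho>) powr (- of_real lam - \<i> * of_real x)
       * of_real (exp ((2 * \<psi> - pi) * x))
       * of_real ((cmod (Gamma (of_real lam + \<i> * of_real x)))\<^sup>2)
       * meixner_pollaczek k lam x \<psi>)
    ((1 - \<rho> * of_real (sin (\<psi> - \<phi>) / sin \<psi>)) powr (- 2 * of_real lam)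
       * (of_real (2 * pi * Gamma (real k + 2 * lam))
           * (\<rho> * of_real (sin \<phi>) / (of_real (sin \<psi>) - \<rho> * of_real (sin (\<psi> - \<phi>)))) ^ k
          / of_real ((2 * sin \<psi>) powr (2 * lam) * fact k)))"
proof -
  define L where "L = mp_log \<psi> \<phi> \<rho>"
  define u where "u = exp L"
  define W where "W = exp (- of_real lam * (Ln (1 - exp (\<i> * of_real \<phi>) * \<rho>) + Ln (1 - exp (- \<i> * of_real \<phi>) * \<rho>)))"
  define z where "z = 1 - exp (- 2 * \<i> * of_real \<psi>)"
  define l where "l = complex_of_real lam"
  define K where "K = W * (pochhammer (2 * l) k / fact k * exp (\<i> * of_nat k * of_real \<psi>))"
  define c where "c = (\<lambda>n. pochhammer (- of_nat k) n / fact n * z ^ n / pochhammer (2 * l) n)"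
  define \<rho>' where "\<rho>' = \<rho> * of_real (sin \<phi>) / (of_real (sin \<psi>) - \<rho> * of_real (sin (\<psi> - \<phi>)))"
  define Q where "Q = exp (l * L - of_real (2 * lam) * Ln (1 + u))"
  have L: "\<bar>Im L\<bar> < pi" unfolding L_def by (intro abs_Im_mp_log_less_pi assms)
  have u: "1 + u \<noteq> 0" using one_plus_exp_notin_nonpos_Reals[OF L] by (auto simp: u_def)
  have l_pos: "2 * l + of_nat n \<notin> \<int>\<^sub>\<le>\<^sub>0" "l + \<i> * of_real x \<notin> \<int>\<^sub>\<le>\<^sub>0" for n x
    using assms(1) by (auto simp: l_def elim!: nonpos_Ints_cases dest!: arg_cong[where f = Re])
  have l2_pos: "2 * l \<notin> \<int>\<^sub>\<le>\<^sub>0" using l_pos(1)[of 0] by simp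
  \<comment> \<open>The transform is used with a = lam + n and b = lam. Raising n by one adds L - Ln
    (1 + u) to the exponent, hence the powers of u / (1 + u).\<close>
  have terms: "has_bochner_integral lborel
     (\<lambda>x. K * c n * (Gamma (of_real (lam + n) + \<i> * of_real x) * Gamma (l - \<i> * of_real x) * exp (- (\<i> * of_real x * L))))
     (2 * pi * Gamma (2 * l) * K * Q * (pochhammer (- of_nat k) n / fact n * (z * (u / (1 + u))) ^ n))" for n
  proof -
    have "has_bochner_integral lborel
     (\<lambda>x. K * c n * (Gamma (of_real (lam + n) + \<i> * of_real x) * Gamma (l - \<i> * of_real x) * exp (- (\<i> * of_real x * L))))
     (K * c n * (2 * pi * Gamma (complex_of_real (lam + n + lam)) * exp (of_real (lam + n) * L - of_real (lam + n + lam) * Ln (1 + u))))"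
      unfolding l_def u_def using assms(1) L by (intro has_bochner_integral_mult_right Gamma_Gamma_laplace) auto
    moreover have "exp (of_real (lam + n) * L - of_real (lam + n + lam) * Ln (1 + u)) = Q * (u / (1 + u)) ^ n"
    proof -
      have "of_real (lam + n) * L - of_real (lam + n + lam) * Ln (1 + u)
          = (l * L - of_real (2 * lam) * Ln (1 + u)) + of_nat n * (L - Ln (1 + u))"
        by (simp add: l_def algebra_simps)
      also have "exp \<dots> = Q * exp (L - Ln (1 + u)) ^ n"
        by (simp only: exp_add exp_of_nat_mult Q_def)
      also have "exp (L - Ln (1 + u)) = u / (1 + u)" using u by (simp add: exp_diff u_def)
      finally show ?thesis .
    qed
    moreover have "Gamma (complex_of_real (lam + n + lam)) = pochhammer (2 * l) n * Gamma (2 * l)"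
    proof -
      have "complex_of_real (lam + n + lam) = 2 * l + of_nat n" by (simp add: l_def)
      thus ?thesis using pochhammer_Gamma[OF l2_pos, of n] l2_pos by (simp add: Gamma_eq_zero_iff)
    qed
    moreover have "pochhammer (2 * l) n \<noteq> 0"
      using l2_pos by (auto simp: pochhammer_eq_0_iff)
    ultimately show ?thesis by (simp add: c_def power_mult_distrib power_divide mult_ac)
  qed
  have integrand: "(1 - exp (\<i> * of_real \<phi>) * \<rho>) powr (- of_real lam + \<i> * of_real x)
       * (1 - exp (- \<i> * of_real \<phi>) * \<rho>) powr (- of_real lam - \<i> * of_real x)
       * of_real (exp ((2 * \<psi> - pi) * x))
       * of_real ((cmod (Gamma (of_real lam + \<i> * of_real x)))\<^sup>2)
       * meixner_pollaczek k lam x \<psi>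
     = (\<Sum>n\<le>k. K * c n * (Gamma (of_real (lam + n) + \<i> * of_real x) * Gamma (l - \<i> * of_real x) * exp (- (\<i> * of_real x * L))))" for x
  proof -
    have "of_real ((cmod (Gamma (of_real lam + \<i> * of_real x)))\<^sup>2) = Gamma (l + \<i> * of_real x) * Gamma (l - \<i> * of_real x)"
      unfolding complex_norm_square by (simp add: cnj_Gamma l_def)
    moreover have "Gamma (of_real (lam + n) + \<i> * of_real x) = pochhammer (l + \<i> * of_real x) n * Gamma (l + \<i> * of_real x)" for n :: nat
    proof -
      have eq: "of_real (lam + n) + \<i> * of_real x = (l + \<i> * of_real x) + of_nat n" by (simp add: l_def)
      show ?thesis unfolding eq using pochhammer_Gamma[OF l_pos(2), of x n] l_pos(2)[of x] by (simp add: Gamma_eq_zero_iff)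
    qed
    ultimately show ?thesis
      unfolding mp_weight[OF assms(2-4)] meixner_pollaczek_eq_sum
      unfolding L_def[symmetric] W_def[symmetric]
      unfolding l_def[symmetric] z_def[symmetric] K_def c_def sum_distrib_left
      by (intro sum.cong) (simp_all add: mult_ac)
  qed
  have "has_bochner_integral lborel
     (\<lambda>x. \<Sum>n\<le>k. K * c n * (Gamma (of_real (lam + n) + \<i> * of_real x) * Gamma (l - \<i> * of_real x) * exp (- (\<i> * of_real x * L))))
     (\<Sum>n\<le>k. 2 * pi * Gamma (2 * l) * K * Q * (pochhammer (- of_nat k) n / fact n * (z * (u / (1 + u))) ^ n))"
    by (intro has_bochner_integral_sum terms)
  also have "(\<Sum>n\<le>k. 2 * pi * Gamma (2 * l) * K * Q * (pochhammer (- of_nat k) n / fact n * (z * (u / (1 + u))) ^ n))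
     = 2 * pi * Gamma (2 * l) * K * Q * (exp (- \<i> * of_real \<psi>) * \<rho>') ^ k"
    unfolding sum_distrib_left[symmetric] sum_pochhammer_neg
    unfolding z_def u_def L_def mp_log_quotient[OF assms(2-4)] \<rho>'_def ..
  \<comment> \<open>The factor exp (i k \<psi>) of the polynomial cancels the k-th power of exp (- i
    \<psi>) left by the binomial sum.\<close>
  also have "\<dots> = (W * Q) * (2 * pi * (pochhammer (2 * l) k * Gamma (2 * l)) * \<rho>' ^ k / fact k)"
  proof -
    have "exp (\<i> * of_nat k * of_real \<psi>) * exp (- \<i> * of_real \<psi>) ^ k = 1"
      by (simp add: algebra_simps flip: exp_of_nat_mult exp_add)
    hence "exp (\<i> * of_nat k * of_real \<psi>) * (exp (- \<i> * of_real \<psi>) * \<rho>') ^ k = \<rho>' ^ k"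
      by (simp add: power_mult_distrib flip: mult.assoc)
    moreover have "2 * pi * Gamma (2 * l) * K * Q * (exp (- \<i> * of_real \<psi>) * \<rho>') ^ k =
       (W * Q) * (2 * pi * (pochhammer (2 * l) k * Gamma (2 * l)) * (exp (\<i> * of_nat k * of_real \<psi>) * (exp (- \<i> * of_real \<psi>) * \<rho>') ^ k) / fact k)"
      by (simp add: K_def mult_ac)
    ultimately show ?thesis by simp
  qed
  also have "pochhammer (2 * l) k * Gamma (2 * l) = complex_of_real (Gamma (real k + 2 * lam))"
  proof -
    have eq: "2 * l + of_nat k = complex_of_real (real k + 2 * lam)" by (simp add: l_def)
    have "pochhammer (2 * l) k * Gamma (2 * l) = Gamma (2 * l + of_nat k)"
      using pochhammer_Gamma[OF l2_pos, of k] l2_pos by (simp add: Gamma_eq_zero_iff)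
    thus ?thesis unfolding eq by (simp only: Gamma_complex_of_real)
  qed
  also have "W * Q = (1 - \<rho> * of_real (sin (\<psi> - \<phi>) / sin \<psi>)) powr (- 2 * of_real lam) / of_real ((2 * sin \<psi>) powr (2 * lam))"
    unfolding W_def Q_def u_def L_def l_def by (rule mp_prefactor[OF assms(2-4)])
  finally show ?thesis
    unfolding integrand by (simp add: \<rho>'_def)
qed

end
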